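(* Let $G$ be any finite connected simple graph. Let $\iota$ be the matrix associated to any $\mathbb{Z}$-basis for the lattice of integral flows $\mathcal{F}(G)$, and let $\mathcal{L}^* = \iota^T\iota$ denote the associated dual Laplacian. Then there is an isomorphism of groups $$\kappa(G) \cong \mathbb{Z}^g/\operatorname{im} \mathcal{L}^*,$$ where $\kappa(G)$ is the critical group of $G$, $g = |E|-|V|+1$, and $\operatorname{im}\mathcal{L}^*$ is the image of $\mathcal{L}^*:\mathbb{Z}^g\to\mathbb{Z}^g$.
   Context: Let $G=(V,E)$ be a finite connected undirected simple graph on $V=\{0,1,\dots,n\}$, with vertex $0$ designated as the root, and with a fixed orientation of its edges. Let $\partial : \mathbb{R}^E \to \mathbb{R}^V$ be the signed incidence matrix: the column of an edge has an entry $-1$ in the row of one endpoint and $+1$ in the row of the other endpoint (according to the orientation), and $0$ elsewhere. The lattice of integral flows of $G$ is $\mathcal{F}(G) = \mathbb{Z}^E \cap \ker(\partial)$, a free abelian group of rank $g = |E|-|V|+1$. The matrix associated to a $\mathbb{Z}$-basis $\{\mathbf{f}_1,\dots,\mathbf{f}_g\}$ of $\mathcal{F}(G)$ is the $|E|\times g$ matrix $\iota$ with columns $\mathbf{f}_1,\dots,\mathbf{f}_g$. Critical group: a configuration is a vector $\mathbf{c}=(c_1,\dots,c_n)\in\mathbb{N}^n$ of chips on the non-root vertices. A non-root vertex $i$ can fire if $c_i\ge\deg(i)$, in which case it passes one chip along each incident edge (chips sent to the root are discarded). A configuration is stable if no non-root vertex can fire; in this case the root can fire, adding one chip to each neighbor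 of $0$. A stable configuration $\mathbf{c}$ is recurrent if after firing the root there is a sequence of firings returning to $\mathbf{c}$. The stable and recurrent configurations form a group $\kappa(G)$ under coordinatewise addition followed by stabilization, called the critical group. It is a standard fact that $\kappa(G)\cong\mathbb{Z}^{|V|-1}/\operatorname{im}\tilde{\mathcal{L}}$, where $\tilde{\mathcal{L}}=\tilde\partial\tilde\partial^T$ is the reduced Laplacian and $\tilde\partial$ is obtained from $\partial$ by deleting the row of the root. *)

theory Defs
  imports Jordan_Normal_Form.Matrix "HOL-Algebra.Coset"
begin

(* Graphs have vertex set {0..n} with root 0; an undirected edge is a two-element set of vertices. *)

definition simple_graph :: "nat \<Rightarrow> nat set set \<Rightarrow> bool" where
  "simple_graph n E \<longleftrightarrow> E \<subseteq> {e. e \<subseteq> {0..n} \<and> card e = 2}"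

definition connected_graph :: "nat \<Rightarrow> nat set set \<Rightarrow> bool" where
  "connected_graph n E \<longleftrightarrow> (\<forall>u\<in>{0..n}. \<forall>v\<in>{0..n}. (u, v) \<in> {(a, b). {a, b} \<in> E}\<^sup>*)"

definition degree :: "nat set set \<Rightarrow> nat \<Rightarrow> nat" where
  "degree E v = card {e \<in> E. v \<in> e}"

(* |E| - |V| + 1; the 1 is added first because subtraction on nat truncates
   (a tree has |E| = |V| - 1). *)
definition cycle_rank :: "nat \<Rightarrow> nat set set \<Rightarrow> nat" where
  "cycle_rank n E = card E + 1 - card {0..n}"

(* The list es fixes an orientation of the edges (pairs are (tail, head)) and, at the same time,
   the numbering of the edges used as coordinates: each edge occurs exactly once,
   in exactly one direction. *)
definition orientation :: "nat set set \<Rightarrow> (nat \<times> nat) list \<Rightarrow> bool" where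
  "orientation E es \<longleftrightarrow>
     distinct (map (\<lambda>(u, v). {u, v}) es) \<and> set (map (\<lambda>(u, v). {u, v}) es) = E"

definition incidence_matrix :: "nat \<Rightarrow> (nat \<times> nat) list \<Rightarrow> real mat" where
  "incidence_matrix n es = mat (n + 1) (length es)
     (\<lambda>(v, j). if v = fst (es ! j) then -1 else if v = snd (es ! j) then 1 else 0)"

(* The intersection of the integer lattice with the kernel of the real incidence matrix. *)
definition flow_lattice :: "nat \<Rightarrow> (nat \<times> nat) list \<Rightarrow> int vec set" where
  "flow_lattice n es = {f \<in> carrier_vec (length es).
     incidence_matrix n es *\<^sub>v map_vec real_of_int f = 0\<^sub>v (n + 1)}"

definition Z_basis :: "nat \<Rightarrow> int vec set \<Rightarrow> int vec list \<Rightarrow> bool" where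
  "Z_basis m \<Lambda> fs \<longleftrightarrow>
     set fs \<subseteq> \<Lambda> \<and>
     (\<forall>f\<in>\<Lambda>. \<exists>x\<in>carrier_vec (length fs). f = mat_of_cols m fs *\<^sub>v x) \<and>
     (\<forall>x\<in>carrier_vec (length fs). mat_of_cols m fs *\<^sub>v x = 0\<^sub>v m \<longrightarrow> x = 0\<^sub>v (length fs))"

definition dual_laplacian :: "int mat \<Rightarrow> int mat" where
  "dual_laplacian \<iota> = transpose_mat \<iota> * \<iota>"

(* An element of N^n, indexed by the non-root vertices {1..n}, is represented by a function that
   vanishes outside {1..n}. *)
definition configs :: "nat \<Rightarrow> (nat \<Rightarrow> nat) set" where
  "configs n = {c. \<forall>i. i \<notin> {1..n} \<longrightarrow> c i = 0}"

definition can_fire :: "nat \<Rightarrow> nat set set \<Rightarrow> (nat \<Rightarrow> nat) \<Rightarrow> nat \<Rightarrow> bool" where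
  "can_fire n E c i \<longleftrightarrow> i \<in> {1..n} \<and> degree E i \<le> c i"

(* The restriction to j in {1..n} discards the chips sent to the root. *)
definition fire :: "nat \<Rightarrow> nat set set \<Rightarrow> nat \<Rightarrow> (nat \<Rightarrow> nat) \<Rightarrow> nat \<Rightarrow> nat" where
  "fire n E i c = (\<lambda>j. if j = i then c j - degree E i
                        else if j \<in> {1..n} \<and> {i, j} \<in> E then c j + 1 else c j)"

definition fires_to :: "nat \<Rightarrow> nat set set \<Rightarrow> (nat \<Rightarrow> nat) \<Rightarrow> (nat \<Rightarrow> nat) \<Rightarrow> bool" where
  "fires_to n E c d \<longleftrightarrow> (\<exists>i. can_fire n E c i \<and> d = fire n E i c)"

definition stable :: "nat \<Rightarrow> nat set set \<Rightarrow> (nat \<Rightarrow> nat) \<Rightarrow> bool" where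
  "stable n E c \<longleftrightarrow> (\<forall>i. \<not> can_fire n E c i)"

definition fire_root :: "nat \<Rightarrow> nat set set \<Rightarrow> (nat \<Rightarrow> nat) \<Rightarrow> nat \<Rightarrow> nat" where
  "fire_root n E c = (\<lambda>j. if j \<in> {1..n} \<and> {0, j} \<in> E then c j + 1 else c j)"

definition recurrent :: "nat \<Rightarrow> nat set set \<Rightarrow> (nat \<Rightarrow> nat) \<Rightarrow> bool" where
  "recurrent n E c \<longleftrightarrow> stable n E c \<and> (fires_to n E)\<^sup>*\<^sup>* (fire_root n E c) c"

(* For a connected graph every configuration reaches exactly one stable configuration. *)
definition stabilization :: "nat \<Rightarrow> nat set set \<Rightarrow> (nat \<Rightarrow> nat) \<Rightarrow> nat \<Rightarrow> nat" where
  "stabilization n E c = (THE d. stable n E d \<and> (fires_to n E)\<^sup>*\<^sup>* c d)"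

definition recurrent_configs :: "nat \<Rightarrow> nat set set \<Rightarrow> (nat \<Rightarrow> nat) set" where
  "recurrent_configs n E = {c \<in> configs n. recurrent n E c}"

definition config_add :: "nat \<Rightarrow> nat set set \<Rightarrow> (nat \<Rightarrow> nat) \<Rightarrow> (nat \<Rightarrow> nat) \<Rightarrow> nat \<Rightarrow> nat" where
  "config_add n E c d = stabilization n E (\<lambda>i. c i + d i)"

(* The identity is in general not the zero configuration, which need not be recurrent;
   it is determined by the addition. *)
definition critical_group :: "nat \<Rightarrow> nat set set \<Rightarrow> (nat \<Rightarrow> nat) monoid" where
  "critical_group n E = \<lparr>
     carrier = recurrent_configs n E,
     mult = config_add n E,
     one = (THE e. e \<in> recurrent_configs n E \<and>
                   (\<forall>c\<in>recurrent_configs n E. config_add n E e c = c)) \<rparr>"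

end

theory Submission
  imports Defs
begin

text \<open>
  A stable configuration is recurrent iff it has no forbidden subconfiguration (Dhar). Firing preserves
  the absence of forbidden subconfigurations, and a maximum principle shows that every class of
  $\mathbb{Z}^n$ modulo the image of the reduced Laplacian contains exactly one stable configuration of this kind;
  this identifies the critical group with $\mathbb{Z}^n / \operatorname{im} \tilde{\mathcal{L}}$.

  Paths from the root give an integral right inverse $S$ of the reduced incidence matrix $D$. Since
  $x - S D x$ is a flow, there is an integral $R$ with $\iota R + S D = 1$ and $R \iota = 1$. Traces give
  the rank $g$, transposition gives $\ker \iota^T = \operatorname{im} D^T$, and $c \mapsto \iota^T S c$
  induces the isomorphism from $\mathbb{Z}^n / \operatorname{im} D D^T$ onto $\mathbb{Z}^g / \operatorname{im} \iota^T \iota$.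
\<close>

section \<open>Transport of a group structure along a bijection\<close>

text \<open>Injectivity of \<open>\<phi>\<close> reflects associativity and the unit law from
  \<open>G\<close> back to \<open>K\<close>, and surjectivity provides inverses. This serves for the
  critical group, whose axioms are awkward to check directly on stabilizations.\<close>

lemma (in group) group_of_bij:
  fixes K :: "('c, 'd) monoid_scheme"
  assumes bij: "bij_betw \<phi> (carrier K) (carrier G)"
    and hom: "\<And>x y. x \<in> carrier K \<Longrightarrow> y \<in> carrier K \<Longrightarrow> \<phi> (x \<otimes>\<^bsub>K\<^esub> y) = \<phi> x \<otimes> \<phi> y"
    and closed: "\<And>x y. x \<in> carrier K \<Longrightarrow> y \<in> carrier K \<Longrightarrow> x \<otimes>\<^bsub>K\<^esub> y \<in> carrier K"
    and one: "\<one>\<^bsub>K\<^esub> \<in> carrier K" "\<phi> \<one>\<^bsub>K\<^esub> = \<one>"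
  shows "group K" and "K \<cong> G"
proof -
  have mem: "\<phi> x \<in> carrier G" if "x \<in> carrier K" for x
    using bij that by (auto simp: bij_betw_def)
  have inj: "x = y" if "\<phi> x = \<phi> y" "x \<in> carrier K" "y \<in> carrier K" for x y
    using bij that by (auto simp: bij_betw_def dest: inj_onD)
  show "group K"
  proof (rule groupI)
    show "x \<otimes>\<^bsub>K\<^esub> y \<otimes>\<^bsub>K\<^esub> z = x \<otimes>\<^bsub>K\<^esub> (y \<otimes>\<^bsub>K\<^esub> z)"
      if "x \<in> carrier K" "y \<in> carrier K" "z \<in> carrier K" for x y z
      using that by (intro inj) (auto simp: hom closed mem m_assoc)
    show "\<one>\<^bsub>K\<^esub> \<otimes>\<^bsub>K\<^esub> x = x" if "x \<in> carrier K" for x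
      using that by (intro inj) (auto simp: hom closed mem one)
    show "\<exists>y\<in>carrier K. y \<otimes>\<^bsub>K\<^esub> x = \<one>\<^bsub>K\<^esub>" if x: "x \<in> carrier K" for x
    proof -
      have "inv (\<phi> x) \<in> \<phi> ` carrier K"
        using bij mem[OF x] by (simp add: bij_betw_def)
      then obtain y where y: "y \<in> carrier K" "\<phi> y = inv (\<phi> x)" by auto
      have "y \<otimes>\<^bsub>K\<^esub> x = \<one>\<^bsub>K\<^esub>"
        by (rule inj) (auto simp: hom closed mem one x y)
      with y show ?thesis by blast
    qed
  qed (auto simp: closed one)
  have "\<phi> \<in> iso K G"
    using bij by (auto simp: iso_def hom_def hom mem)
  then show "K \<cong> G" by (auto simp: is_iso_def)
qed

section \<open>Recurrent configurations and the Laplacian\<close>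

locale rooted_graph =
  fixes n :: nat and E :: "nat set set"
  assumes simple: "simple_graph n E"
    and connected: "connected_graph n E"
begin

definition nbrs :: "nat \<Rightarrow> nat set" where
  "nbrs v = {w. {v, w} \<in> E}"

text \<open>The full graph Laplacian with the root included. On functions with
  \<open>f 0 = 0\<close>, evaluated on \<open>{1..n}\<close>, it is the reduced Laplacian.\<close>

definition lap :: "(nat \<Rightarrow> int) \<Rightarrow> nat \<Rightarrow> int" where
  "lap f v = (\<Sum>w\<in>nbrs v. f v - f w)"

lemma edge_bounds: "{v, w} \<in> E \<Longrightarrow> v \<le> n \<and> w \<le> n \<and> v \<noteq> w"
  using simple by (auto simp: simple_graph_def card_2_iff doubleton_eq_iff)

lemma nbrs_sym: "w \<in> nbrs v \<longleftrightarrow> v \<in> nbrs w"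
  by (simp add: nbrs_def insert_commute)

lemma nbrs_irrefl [simp]: "v \<notin> nbrs v"
  using edge_bounds[of v v] by (auto simp: nbrs_def)

lemma nbrs_subset: "nbrs v \<subseteq> {0..n}"
  using edge_bounds by (auto simp: nbrs_def)

lemma finite_nbrs [simp]: "finite (nbrs v)"
  using nbrs_subset finite_subset by blast

lemma degree_eq: "degree E v = card (nbrs v)"
proof -
  have "{e \<in> E. v \<in> e} = (\<lambda>w. {v, w}) ` nbrs v"
  proof (intro equalityI subsetI)
    fix e assume "e \<in> {e \<in> E. v \<in> e}"
    moreover from this obtain a b where "e = {a, b}"
      using simple by (auto simp: simple_graph_def card_2_iff)
    ultimately show "e \<in> (\<lambda>w. {v, w}) ` nbrs v"
      by (auto simp: nbrs_def insert_commute)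
  qed (auto simp: nbrs_def)
  moreover have "inj_on (\<lambda>w. {v, w}) (nbrs v)"
    by (auto simp: inj_on_def doubleton_eq_iff)
  ultimately show ?thesis
    by (simp add: degree_def card_image)
qed

section \<open>Firing expressed through the Laplacian\<close>

definition ind :: "nat set \<Rightarrow> nat \<Rightarrow> int" where
  "ind B v = of_bool (v \<in> B)"

lemma lap_diff: "lap (\<lambda>v. f v - h v) v = lap f v - lap h v"
  by (simp add: lap_def sum_subtractf[symmetric] algebra_simps)

lemma lap_add: "lap (\<lambda>v. f v + h v) v = lap f v + lap h v"
  by (simp add: lap_def sum.distrib[symmetric] algebra_simps)

lemma lap_cmult: "lap (\<lambda>v. t * f v) v = t * lap f v"
  by (simp add: lap_def sum_distrib_left algebra_simps)

lemma lap_zero [simp]: "lap (\<lambda>v. 0) v = 0"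
  by (simp add: lap_def)

lemma lap_ind:
  "lap (ind B) v =
    (if v \<in> B then int (card (nbrs v)) else 0) - int (card (nbrs v \<inter> B))"
  by (simp add: lap_def ind_def sum_subtractf)

text \<open>Legality of the move makes the truncated subtraction in \<open>fire\<close> exact, so
  over the integers a firing subtracts a Laplacian column.\<close>

lemma fire_eq_lap:
  assumes "can_fire n E c i" "v \<in> {1..n}"
  shows "int (fire n E i c v) = int (c v) - lap (ind {i}) v"
proof -
  have "nbrs v \<inter> {i} = (if {i, v} \<in> E then {i} else {})"
    by (auto simp: nbrs_def insert_commute)
  moreover have "{v, v} \<notin> E" using edge_bounds[of v v] by auto
  ultimately show ?thesis
    using assms
    by (auto simp: lap_ind fire_def can_fire_def degree_eq of_nat_diff)
qed

text \<open>The Laplacian kills constants, so subtracting the column of the root amounts to adding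
  the columns of all other vertices.\<close>

lemma fire_root_eq_lap:
  assumes "v \<in> {1..n}"
  shows "int (fire_root n E c v) = int (c v) + lap (ind {1..n}) v"
proof -
  have "nbrs v = (nbrs v \<inter> {1..n}) \<union> (if {0, v} \<in> E then {0} else {})"
  proof (intro equalityI subsetI)
    fix w assume w: "w \<in> nbrs v"
    then have "w \<le> n" using nbrs_subset by fastforce
    with w show "w \<in> nbrs v \<inter> {1..n} \<union> (if {0, v} \<in> E then {0} else {})"
      by (cases "w = 0") (auto simp: nbrs_def insert_commute)
  qed (auto simp: nbrs_def insert_commute split: if_splits)
  also have "card \<dots> = card (nbrs v \<inter> {1..n}) + (if {0, v} \<in> E then 1 else 0)"
    by (subst card_Un_disjoint) auto
  finally show ?thesis
    using assms unfolding lap_ind by (auto simp: fire_root_def)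
qed

section \<open>Invariants of firing sequences\<close>

lemma fire_in_configs: "c \<in> configs n \<Longrightarrow> can_fire n E c i \<Longrightarrow> fire n E i c \<in> configs n"
  by (auto simp: configs_def can_fire_def fire_def)

lemma fire_root_in_configs: "c \<in> configs n \<Longrightarrow> fire_root n E c \<in> configs n"
  by (auto simp: configs_def fire_root_def)

text \<open>Ample means that no nonempty subset of \<open>F\<close> is a forbidden subconfiguration in the sense of Dhar.\<close>

definition ample :: "nat set \<Rightarrow> (nat \<Rightarrow> nat) \<Rightarrow> bool" where
  "ample F c \<longleftrightarrow> (\<forall>A\<subseteq>F. A \<noteq> {} \<longrightarrow> (\<exists>v\<in>A. card (nbrs v \<inter> A) \<le> c v))"

text \<open>The witness for \<open>A - {i}\<close> also serves for \<open>A\<close>: putting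
  \<open>i\<close> back adds at most one neighbour, and only to a vertex adjacent to
  \<open>i\<close>, which has just received a chip. The remaining set \<open>{i}\<close> has no
  edges inside. Hence a vertex may join \<open>F\<close> when it fires.\<close>

lemma ample_fire:
  assumes amp: "ample F c" and F: "F \<subseteq> {1..n}" and i: "can_fire n E c i"
  shows "ample (insert i F) (fire n E i c)"
  unfolding ample_def
proof (intro allI impI)
  fix A assume A: "A \<subseteq> insert i F" "A \<noteq> {}"
  then have An: "A \<subseteq> {1..n}" using F i by (auto simp: can_fire_def)
  show "\<exists>v\<in>A. card (nbrs v \<inter> A) \<le> fire n E i c v"
  proof (cases "A = {i}")
    case True
    have "nbrs i \<inter> {i} = {}" by auto
    then show ?thesis using True by simp
  next
    case False
    then have "A - {i} \<subseteq> F" "A - {i} \<noteq> {}" using A by auto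
    then obtain v where v: "v \<in> A - {i}" "card (nbrs v \<inter> (A - {i})) \<le> c v"
      using amp unfolding ample_def by meson
    have "card (nbrs v \<inter> A) \<le> card (nbrs v \<inter> (A - {i})) + of_bool (i \<in> nbrs v)"
    proof (cases "i \<in> nbrs v")
      case True
      have "card (nbrs v \<inter> A) \<le> card (insert i (nbrs v \<inter> (A - {i})))"
        by (rule card_mono) auto
      also have "\<dots> \<le> Suc (card (nbrs v \<inter> (A - {i})))"
        by (simp add: card_insert_if)
      finally show ?thesis using True by simp
    next
      case False
      then have "nbrs v \<inter> A = nbrs v \<inter> (A - {i})" by auto
      then show ?thesis by simp
    qed
    also have "\<dots> \<le> fire n E i c v"
      using v An by (auto simp: fire_def nbrs_def insert_commute)
    finally show ?thesis using v by blast
  qed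
qed

lemma ample_mono: "ample F c \<Longrightarrow> (\<And>v. v \<in> F \<Longrightarrow> c v \<le> d v) \<Longrightarrow> ample F d"
  unfolding ample_def by (meson order_trans subsetD)

text \<open>Here \<open>u\<close> counts how often each vertex fires. Its support starts empty and
  grows by the fired vertex, so \<open>ample_fire\<close> keeps the set of vertices that have fired
  ample, whatever the start; the same lemma with \<open>F = {1..n}\<close> preserves full
  ampleness.\<close>

lemma fires_to_rtranclp:
  assumes "(fires_to n E)\<^sup>*\<^sup>* c d" "c \<in> configs n"
  shows "d \<in> configs n \<and>
    (ample {1..n} c \<longrightarrow> ample {1..n} d) \<and>
    (\<exists>u. (\<forall>v. 0 \<le> u v) \<and> (\<forall>v. v \<notin> {1..n} \<longrightarrow> u v = 0) \<and>
         ample {v. 0 < u v} d \<and> (\<forall>v\<in>{1..n}. int (d v) = int (c v) - lap u v))"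
  using assms
proof (induction rule: rtranclp_induct)
  case base
  then show ?case by (auto intro!: exI[of _ "\<lambda>_. 0"] simp: ample_def)
next
  case (step d e)
  from step.hyps obtain i where i: "can_fire n E d i" "e = fire n E i d"
    by (auto simp: fires_to_def)
  from step obtain u where u: "\<And>v. 0 \<le> u v" "\<And>v. v \<notin> {1..n} \<Longrightarrow> u v = 0" "ample {v. 0 < u v} d"
      "\<And>v. v \<in> {1..n} \<Longrightarrow> int (d v) = int (c v) - lap u v"
    by blast
  have in1: "i \<in> {1..n}" using i by (simp add: can_fire_def)
  have supp: "{v. 0 < u v} \<subseteq> {1..n}" using u(2) by force
  define u' where "u' = (\<lambda>v. u v + ind {i} v)"
  have "{v. 0 < u' v} = insert i {v. 0 < u v}"
    using u(1) by (auto simp: u'_def ind_def add_nonneg_pos)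
  then have "ample {v. 0 < u' v} e"
    using ample_fire[OF u(3) supp i(1)] i(2) by simp
  moreover have "int (e v) = int (c v) - lap u' v" if "v \<in> {1..n}" for v
    unfolding u'_def lap_add using fire_eq_lap[OF i(1) that] u(4)[OF that] i(2) by simp
  moreover have "\<forall>v. 0 \<le> u' v" "\<forall>v. v \<notin> {1..n} \<longrightarrow> u' v = 0"
    using u in1 by (auto simp: u'_def ind_def)
  moreover have "ample {1..n} d \<longrightarrow> ample {1..n} e"
    using ample_fire[of "{1..n}" d i] i in1 by (auto simp: insert_absorb)
  moreover have "e \<in> configs n"
    using step i fire_in_configs by blast
  ultimately show ?case using step by blast
qed


section \<open>Termination of firing\<close>

text \<open>Symmetry of the Laplacian: pairing \<open>h\<close> with a column is evaluating the
  corresponding row at \<open>h\<close>. The root is missing from the sum, which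
  \<open>h 0 = 0\<close> makes harmless.\<close>

lemma sum_mult_lap_ind:
  assumes i: "i \<in> {1..n}" and h: "h 0 = 0"
  shows "(\<Sum>v\<in>{1..n}. h v * lap (ind {i}) v) = lap h i"
proof -
  have nb: "nbrs v \<inter> {i} = (if v \<in> nbrs i then {i} else {})" for v
    using nbrs_sym[of v i] by auto
  have "(\<Sum>v\<in>{1..n}. h v * lap (ind {i}) v)
      = (\<Sum>v\<in>{1..n}. (if v = i then h v * int (card (nbrs v)) else 0) - (if v \<in> nbrs i then h v else 0))"
    by (intro sum.cong) (auto simp: lap_ind nb)
  also have "\<dots> = h i * int (card (nbrs i)) - (\<Sum>v\<in>{1..n}. if v \<in> nbrs i then h v else 0)"
    using i by (simp add: sum_subtractf sum.delta)
  also have "(\<Sum>v\<in>{1..n}. if v \<in> nbrs i then h v else 0) = (\<Sum>v\<in>nbrs i. h v)"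
  proof (rule sum.mono_neutral_cong)
    show "h v = 0" if "v \<in> nbrs i - {1..n}" for v
      using that h nbrs_subset[of i] by (cases "v = 0") auto
  qed auto
  finally show ?thesis by (simp add: lap_def sum_subtractf)
qed

text \<open>With \<open>d v\<close> the distance to the root, \<open>h v = M ^ N - M ^ (N - d v)\<close> is so concave in \<open>d v\<close> that the
  gain over one neighbour closer to the root outweighs all other neighbours.\<close>

lemma superharmonic_exists:
  obtains h :: "nat \<Rightarrow> int" where "h 0 = 0" "\<And>v. 0 \<le> h v" "\<And>v. v \<in> {1..n} \<Longrightarrow> 1 \<le> lap h v"
proof -
  let ?r = "{(a, b). {a, b} \<in> E}"
  define d where "d v = (LEAST k. (0, v) \<in> ?r ^^ k)" for v
  define N where "N = Max (d ` {0..n})"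
  \<comment> \<open>The neighbour closer to the root contributes at least
    \<open>(M - 1) * ?P\<close>, and each of the at most \<open>n\<close> others at least
    \<open>- ?P\<close>, where \<open>?P = M ^ (N - d v)\<close>. The base \<open>n + 2\<close>
    leaves a surplus of \<open>?P\<close>, which is at least 1.\<close>
  define M :: int where "M = int n + 2"
  define h where "h v = (if v \<le> n then M ^ N - M ^ (N - d v) else 0)" for v
  have M1: "1 \<le> M" by (simp add: M_def)
  have dpath: "(0, v) \<in> ?r ^^ d v" if "v \<le> n" for v
  proof -
    have "(0, v) \<in> ?r\<^sup>*"
      using connected that by (auto simp: connected_graph_def)
    then show ?thesis
      unfolding d_def rtrancl_power by (auto intro: LeastI)
  qed
  have dN: "d v \<le> N" if "v \<le> n" for v
    unfolding N_def by (rule Max_ge) (use that in auto)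
  have d0: "d 0 = 0" unfolding d_def by (rule Least_eq_0) simp
  have h0: "h 0 = 0" by (simp add: h_def d0)
  have hnonneg: "0 \<le> h v" for v
    unfolding h_def using M1 by (auto intro: power_increasing)
  have "1 \<le> lap h v" if v: "v \<in> {1..n}" for v
  proof -
    have dpos: "d v \<noteq> 0"
    proof
      assume "d v = 0"
      with dpath[of v] v show False by simp
    qed
    then obtain k where k: "d v = Suc k" by (cases "d v") auto
    \<comment> \<open>The last edge of a shortest path from the root provides the neighbour that is
      closer to the root.\<close>
    with dpath[of v] v obtain u where u: "(0, u) \<in> ?r ^^ k" "{u, v} \<in> E"
      by auto
    then have "d u \<le> k" unfolding d_def by (intro Least_le)
    then have du: "d u < d v" using k by simp
    have unb: "u \<in> nbrs v" using u by (simp add: nbrs_def insert_commute)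
    have le: "v \<le> n" "u \<le> n" using v edge_bounds[OF u(2)] by auto
    have "d v \<le> N" using dN le by auto
    let ?P = "M ^ (N - d v)"
    have P1: "1 \<le> ?P" using M1 by simp
    have lower: "- ?P \<le> h v - h w" if "w \<in> nbrs v - {u}" for w
    proof -
      have "w \<le> n" using that nbrs_subset[of v] by auto
      moreover have "0 \<le> M ^ (N - d w)" using M1 by simp
      ultimately show ?thesis using le by (simp add: h_def)
    qed
    have "M * ?P = M ^ Suc (N - d v)" by simp
    also have "\<dots> \<le> M ^ (N - d u)"
      by (rule power_increasing) (use du \<open>d v \<le> N\<close> M1 in auto)
    finally have big: "M * ?P - ?P \<le> h v - h u"
      using le by (simp add: h_def)
    have "card (nbrs v - {u}) \<le> card ({0..n} - {u})"
      by (rule card_mono) (use nbrs_subset[of v] in auto)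
    then have "int (card (nbrs v - {u})) \<le> int n" using le by simp
    then have "int (card (nbrs v - {u})) * ?P \<le> int n * ?P"
      using P1 by (intro mult_right_mono) auto
    then have "- (int n * ?P) \<le> (\<Sum>w\<in>nbrs v - {u}. - ?P)" by simp
    also have "\<dots> \<le> (\<Sum>w\<in>nbrs v - {u}. h v - h w)"
      by (rule sum_mono) (rule lower)
    finally have "M * ?P - ?P - int n * ?P \<le> lap h v"
      unfolding lap_def using big by (simp add: sum.remove[OF _ unb])
    moreover have "M * ?P - ?P - int n * ?P = ?P" by (simp add: M_def algebra_simps)
    ultimately show ?thesis using P1 by linarith
  qed
  with h0 hnonneg show thesis by (rule that)
qed

text \<open>Weight the chips by a superharmonic \<open>h\<close>: the total \<open>pot\<close> is a
  nonnegative integer, and firing \<open>i\<close> lowers it by \<open>lap h i\<close>, which is at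
  least 1.\<close>

lemma stabilizes:
  obtains d where "stable n E d" "(fires_to n E)\<^sup>*\<^sup>* c d"
proof -
  obtain h :: "nat \<Rightarrow> int" where h: "h 0 = 0" "\<And>v. 0 \<le> h v" "\<And>v. v \<in> {1..n} \<Longrightarrow> 1 \<le> lap h v"
    by (rule superharmonic_exists) blast
  define pot where "pot c = (\<Sum>v\<in>{1..n}. h v * int (c v))" for c
  have dec: "pot (fire n E i c) < pot c" if i: "can_fire n E c i" for c i
  proof -
    have in1: "i \<in> {1..n}" using i by (simp add: can_fire_def)
    have "pot (fire n E i c) = (\<Sum>v\<in>{1..n}. h v * int (c v) - h v * lap (ind {i}) v)"
      unfolding pot_def
      by (intro sum.cong refl) (simp add: fire_eq_lap[OF i] right_diff_distrib)
    also have "\<dots> = pot c - lap h i"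
      using sum_mult_lap_ind[OF in1, of h] h(1) by (simp add: sum_subtractf pot_def)
    finally show ?thesis using h(3)[OF in1] by simp
  qed
  have pos: "0 \<le> pot c" for c unfolding pot_def using h(2) by (simp add: sum_nonneg)
  have "\<exists>d. stable n E d \<and> (fires_to n E)\<^sup>*\<^sup>* c d"
  proof (induction "nat (pot c)" arbitrary: c rule: less_induct)
    case less
    show ?case
    proof (cases "stable n E c")
      case False
      then obtain i where i: "can_fire n E c i" by (auto simp: stable_def)
      obtain d where "stable n E d" "(fires_to n E)\<^sup>*\<^sup>* (fire n E i c) d"
        using less[of "fire n E i c"] dec[OF i] pos[of "fire n E i c"] by fastforce
      moreover have "fires_to n E c (fire n E i c)" using i by (auto simp: fires_to_def)
      ultimately show ?thesis by (meson converse_rtranclp_into_rtranclp)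
    qed auto
  qed
  with that show thesis by blast
qed

text \<open>Maximum principle: the set where a firing vector attains a positive maximum would be a forbidden
  subconfiguration of \<open>d\<close>.\<close>

lemma firing_vector_nonpos:
  assumes stable: "stable n E c" and ample: "ample {1..n} d"
    and f: "f 0 = 0" "\<And>v. v \<in> {1..n} \<Longrightarrow> int (c v) - int (d v) = lap f v"
    and v: "v \<in> {1..n}"
  shows "f v \<le> 0"
proof (rule ccontr)
  assume pos: "\<not> f v \<le> 0"
  define m where "m = Max (f ` {0..n})"
  have le: "f w \<le> m" if "w \<le> n" for w
    unfolding m_def by (rule Max_ge) (use that in auto)
  define A where "A = {w \<in> {0..n}. f w = m}"
  have mpos: "0 < m" using le[of v] pos v by auto
  have "m \<in> f ` {0..n}" unfolding m_def by (rule Max_in) auto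
  then have "A \<noteq> {}" by (auto simp: A_def)
  \<comment> \<open>The maximum is positive while \<open>f 0 = 0\<close>, so the root is not in
    \<open>A\<close>.\<close>
  moreover have A1: "A \<subseteq> {1..n}"
  proof
    fix w assume "w \<in> A"
    then show "w \<in> {1..n}" using mpos f(1) by (cases w) (auto simp: A_def)
  qed
  ultimately obtain w where w: "w \<in> A" "card (nbrs w \<inter> A) \<le> d w"
    using ample unfolding ample_def by meson
  have "f w = m" using w by (simp add: A_def)
  \<comment> \<open>Edges from \<open>w\<close> leaving \<open>A\<close> contribute at least 1 each
    to \<open>lap f w\<close>, edges inside \<open>A\<close> contribute 0. Together with the choice
    of \<open>w\<close> this puts at least \<open>card (nbrs w)\<close> chips of \<open>c\<close> on
    \<open>w\<close>, against stability.\<close>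
  have "int (card (nbrs w - A)) = (\<Sum>x\<in>nbrs w - A. 1)" by simp
  also have "\<dots> \<le> (\<Sum>x\<in>nbrs w - A. f w - f x)"
  proof (rule sum_mono)
    fix x assume x: "x \<in> nbrs w - A"
    then have "x \<le> n" using nbrs_subset[of w] by auto
    moreover from this have "f x \<noteq> m" using x by (simp add: A_def)
    ultimately show "1 \<le> f w - f x" using le[of x] \<open>f w = m\<close> by simp
  qed
  also have "\<dots> = lap f w"
    unfolding lap_def by (rule sum.mono_neutral_left) (auto simp: \<open>f w = m\<close> A_def)
  finally have "int (card (nbrs w - A)) \<le> int (c w) - int (d w)"
    using f(2)[of w] w A1 by auto
  moreover have "c w < card (nbrs w)"
    using stable w A1 unfolding stable_def can_fire_def degree_eq by (meson not_less subsetD)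
  moreover have "card (nbrs w) = card (nbrs w - A) + card (nbrs w \<inter> A)"
    by (subst card_Un_disjoint[symmetric]) (auto intro!: arg_cong[of _ _ card])
  ultimately show False using w(2) by linarith
qed

text \<open>The hypotheses are symmetric in \<open>c\<close> and \<open>d\<close>, so the maximum
  principle applies to \<open>f\<close> and to its negative; hence \<open>f\<close> vanishes on all
  vertices.\<close>

lemma stable_ample_unique:
  assumes "stable n E c" "stable n E d" "ample {1..n} c" "ample {1..n} d"
    and "c \<in> configs n" "d \<in> configs n"
    and f: "f 0 = 0" "\<And>v. v \<in> {1..n} \<Longrightarrow> int (c v) - int (d v) = lap f v"
  shows "c = d"
proof -
  have "f v \<le> 0" if "v \<in> {1..n}" for v
    using firing_vector_nonpos[OF assms(1,4) f that] .
  moreover have "0 \<le> f v" if "v \<in> {1..n}" for v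
  proof -
    have "int (d w) - int (c w) = lap (\<lambda>v. 0 - f v) w" if "w \<in> {1..n}" for w
      using f(2)[OF that] by (subst lap_diff) simp
    from firing_vector_nonpos[OF assms(2,3) _ this that] f(1) show ?thesis by simp
  qed
  ultimately have fz: "f v = 0" if "v \<le> n" for v
    using that f(1) by (cases "v = 0") (auto intro: antisym)
  have "lap f v = 0" if "v \<in> {1..n}" for v
    unfolding lap_def using fz nbrs_subset[of v] that by (intro sum.neutral) auto
  then have "c v = d v" if "v \<in> {1..n}" for v
    using f(2)[OF that] that by simp
  with assms(5,6) show ?thesis
    by (auto simp: configs_def fun_eq_iff) (metis One_nat_def atLeastAtMost_iff)
qed


section \<open>Classes modulo the reduced Laplacian and their representatives\<close>

text \<open>Congruence modulo the image of the reduced Laplacian; values at the root and outside the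
  graph are disregarded.\<close>

definition fequiv :: "(nat \<Rightarrow> int) \<Rightarrow> (nat \<Rightarrow> int) \<Rightarrow> bool" where
  "fequiv x y \<longleftrightarrow> (\<exists>f. f 0 = 0 \<and> (\<forall>v\<in>{1..n}. x v - y v = lap f v))"

lemma fequiv_sym: "fequiv x y \<Longrightarrow> fequiv y x"
  unfolding fequiv_def
proof (elim exE conjE)
  fix f assume f: "f 0 = 0" "\<forall>v\<in>{1..n}. x v - y v = lap f v"
  have "y v - x v = lap (\<lambda>v. 0 - f v) v" if "v \<in> {1..n}" for v
    using f(2) that by (subst lap_diff) (simp add: algebra_simps)
  with f(1) show "\<exists>f. f 0 = 0 \<and> (\<forall>v\<in>{1..n}. y v - x v = lap f v)"
    by (intro exI[of _ "\<lambda>v. 0 - f v"]) auto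
qed

lemma fequiv_trans: "fequiv x y \<Longrightarrow> fequiv y z \<Longrightarrow> fequiv x z"
  unfolding fequiv_def
proof (elim exE conjE)
  fix f g assume f: "f 0 = 0" "\<forall>v\<in>{1..n}. x v - y v = lap f v"
    and g: "g 0 = 0" "\<forall>v\<in>{1..n}. y v - z v = lap g v"
  have "x v - z v = lap (\<lambda>v. f v + g v) v" if "v \<in> {1..n}" for v
  proof -
    have "x v - y v = lap f v" "y v - z v = lap g v" using f(2) g(2) that by blast+
    then show ?thesis unfolding lap_add by linarith
  qed
  with f(1) g(1) show "\<exists>f. f 0 = 0 \<and> (\<forall>v\<in>{1..n}. x v - z v = lap f v)"
    by (intro exI[of _ "\<lambda>v. f v + g v"]) auto
qed

text \<open>These turn out to be the recurrent configurations, see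
  \<open>recurrent_configs_eq\<close>.\<close>

definition stable_ample :: "(nat \<Rightarrow> nat) set" where
  "stable_ample = {c \<in> configs n. stable n E c \<and> ample {1..n} c}"

lemma stable_ample_eqI:
  assumes "c \<in> stable_ample" "d \<in> stable_ample" "fequiv (\<lambda>v. int (c v)) (\<lambda>v. int (d v))"
  shows "c = d"
proof -
  obtain f where "f 0 = 0" "\<And>v. v \<in> {1..n} \<Longrightarrow> int (c v) - int (d v) = lap f v"
    using assms(3) by (auto simp: fequiv_def)
  with assms(1,2) show ?thesis
    unfolding stable_ample_def by (intro stable_ample_unique[of c d f]) auto
qed

lemma fires_to_fequiv:
  assumes "(fires_to n E)\<^sup>*\<^sup>* c d" "c \<in> configs n"
  shows "fequiv (\<lambda>v. int (d v)) (\<lambda>v. int (c v))"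
proof -
  from fires_to_rtranclp[OF assms] obtain u where u: "\<And>v. v \<notin> {1..n} \<Longrightarrow> u v = 0"
    "\<And>v. v \<in> {1..n} \<Longrightarrow> int (d v) = int (c v) - lap u v" by blast
  have "int (c v) - int (d v) = lap u v" if "v \<in> {1..n}" for v
    using u(2)[OF that] by simp
  then have "fequiv (\<lambda>v. int (c v)) (\<lambda>v. int (d v))"
    using u(1)[of 0] unfolding fequiv_def by (intro exI[of _ u]) simp
  then show ?thesis by (rule fequiv_sym)
qed

lemma stabilizes_stable_ample:
  assumes "c \<in> configs n" "ample {1..n} c" "stable n E d" "(fires_to n E)\<^sup>*\<^sup>* c d"
  shows "d \<in> stable_ample" "fequiv (\<lambda>v. int (d v)) (\<lambda>v. int (c v))"
  using fires_to_rtranclp[OF assms(4,1)] fires_to_fequiv[OF assms(4,1)] assms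
  by (auto simp: stable_ample_def)

text \<open>Existence for the definite description comes from \<open>stabilizes\<close>. Uniqueness
  rests on congruence instead of confluence: any two stable results inherit ampleness and the class
  of \<open>c\<close>, hence agree.\<close>

lemma stabilization_stable_ample:
  assumes "c \<in> configs n" "ample {1..n} c"
  shows "stabilization n E c \<in> stable_ample"
    "fequiv (\<lambda>v. int (stabilization n E c v)) (\<lambda>v. int (c v))"
proof -
  obtain d where d: "stable n E d" "(fires_to n E)\<^sup>*\<^sup>* c d" by (rule stabilizes)
  have "e = d" if "stable n E e" "(fires_to n E)\<^sup>*\<^sup>* c e" for e
  proof -
    note e = stabilizes_stable_ample[OF assms that] and d = stabilizes_stable_ample[OF assms d]
    show ?thesis using e(1) d(1) fequiv_trans[OF e(2) fequiv_sym[OF d(2)]] by (rule stable_ample_eqI)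
  qed
  with d have "stabilization n E c = d"
    unfolding stabilization_def by (blast intro: the_equality)
  with stabilizes_stable_ample[OF assms d]
  show "stabilization n E c \<in> stable_ample"
    "fequiv (\<lambda>v. int (stabilization n E c v)) (\<lambda>v. int (c v))" by simp_all
qed

text \<open>Adding a large multiple of \<open>lap h\<close>, with \<open>h\<close> superharmonic, puts at least \<open>n + 1\<close> chips on every
  vertex; such a configuration is ample, and so is its stabilization.\<close>

lemma stable_ample_representative:
  obtains c where "c \<in> stable_ample" "fequiv (\<lambda>v. int (c v)) x"
proof -
  obtain h :: "nat \<Rightarrow> int" where h: "h 0 = 0" "\<And>v. 0 \<le> h v" "\<And>v. v \<in> {1..n} \<Longrightarrow> 1 \<le> lap h v"
    by (rule superharmonic_exists) blast
  \<comment> \<open>Enough to cancel a negative \<open>x v\<close> at any vertex and still leave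
    \<open>n + 1\<close> chips, the number of all vertices.\<close>
  define t where "t = (\<Sum>v\<in>{1..n}. \<bar>x v\<bar>) + int n + 1"
  define c where "c v = (if v \<in> {1..n} then nat (x v + t * lap h v) else 0)" for v
  have big: "int n + 1 \<le> x v + t * lap h v" if v: "v \<in> {1..n}" for v
  proof -
    have "\<bar>x v\<bar> \<le> (\<Sum>v\<in>{1..n}. \<bar>x v\<bar>)" by (rule member_le_sum) (use v in auto)
    moreover have "0 \<le> (\<Sum>v\<in>{1..n}. \<bar>x v\<bar>)" by (simp add: sum_nonneg)
    moreover from this have "t * 1 \<le> t * lap h v"
      by (intro mult_left_mono h v) (simp add: t_def)
    moreover have "t = (\<Sum>v\<in>{1..n}. \<bar>x v\<bar>) + int n + 1" by (simp add: t_def)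
    ultimately show ?thesis by linarith
  qed
  have amp: "ample {1..n} c"
    unfolding ample_def
  proof (intro allI impI)
    fix A :: "nat set" assume "A \<subseteq> {1..n}" "A \<noteq> {}"
    then obtain v where v: "v \<in> A" "v \<in> {1..n}" by blast
    have "card (nbrs v \<inter> A) \<le> card {0..n}"
      by (rule card_mono) (use nbrs_subset[of v] in auto)
    then have "card (nbrs v \<inter> A) \<le> c v"
      using big[OF v(2)] v(2) by (simp add: c_def)
    with v show "\<exists>v\<in>A. card (nbrs v \<inter> A) \<le> c v" by blast
  qed
  have cc: "c \<in> configs n" by (simp add: configs_def c_def)
  obtain d where "stable n E d" "(fires_to n E)\<^sup>*\<^sup>* c d" by (rule stabilizes)
  note d = stabilizes_stable_ample[OF cc amp this]
  have "int (c v) - x v = lap (\<lambda>v. t * h v) v" if "v \<in> {1..n}" for v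
    using big[OF that] that unfolding lap_cmult by (simp add: c_def)
  then have "fequiv (\<lambda>v. int (c v)) x"
    unfolding fequiv_def using h(1) by (intro exI[of _ "\<lambda>v. t * h v"]) simp
  then show thesis using d by (intro that[of d] fequiv_trans[OF d(2)])
qed

section \<open>Recurrent means stable and ample\<close>

text \<open>One half of the injectivity of the reduced Laplacian: apply the maximum principle with
  both configurations equal to one stable ample \<open>c\<close>. Any class supplies such a
  \<open>c\<close>, hence the argument \<open>undefined\<close>.\<close>

lemma lap_kernel_nonpos:
  assumes "f 0 = 0" "\<And>v. v \<in> {1..n} \<Longrightarrow> lap f v = 0" "v \<in> {1..n}"
  shows "f v \<le> 0"
proof -
  obtain c where "c \<in> stable_ample" by (rule stable_ample_representative[of undefined])
  then show ?thesis
    using firing_vector_nonpos[of c c f, OF _ _ assms(1) _ assms(3)] assms(2)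
    by (simp add: stable_ample_def)
qed

text \<open>Returning to \<open>c\<close> after the root has fired forces \<open>lap u\<close> to
  equal \<open>lap (ind {1..n})\<close> on the non-root vertices. The kernel lemma then gives
  \<open>u v \<ge> 1\<close> there, so every non-root vertex has fired, and the set of fired
  vertices is ample.\<close>

lemma recurrent_imp_ample:
  assumes c: "c \<in> configs n" and rec: "recurrent n E c"
  shows "ample {1..n} c"
proof -
  have "(fires_to n E)\<^sup>*\<^sup>* (fire_root n E c) c" using rec by (simp add: recurrent_def)
  from fires_to_rtranclp[OF this fire_root_in_configs[OF c]]
  obtain u where u: "\<And>v. 0 \<le> u v" "\<And>v. v \<notin> {1..n} \<Longrightarrow> u v = 0" "ample {v. 0 < u v} c"
    "\<And>v. v \<in> {1..n} \<Longrightarrow> int (c v) = int (fire_root n E c v) - lap u v" by blast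
  have ker: "lap (\<lambda>v. ind {1..n} v - u v) v = 0" if "v \<in> {1..n}" for v
    using u(4)[OF that] fire_root_eq_lap[OF that, of c] unfolding lap_diff by linarith
  have root: "ind {1..n} 0 - u 0 = 0" using u(2)[of 0] by (simp add: ind_def)
  have "0 < u v" if "v \<in> {1..n}" for v
    using lap_kernel_nonpos[of "\<lambda>v. ind {1..n} v - u v", OF root ker that] that
    by (simp add: ind_def)
  moreover have "v \<in> {1..n}" if "0 < u v" for v using u(2)[of v] that by fastforce
  ultimately have "{v. 0 < u v} = {1..n}" by blast
  with u(3) show ?thesis by simp
qed

text \<open>Dhar's burning algorithm: \<open>A\<close> is the set of vertices not yet burnt.\<close>

lemma burning:
  assumes c: "c \<in> configs n" and amp: "ample {1..n} c"
  shows "d \<in> configs n \<Longrightarrow> A \<subseteq> {1..n} \<Longrightarrow> (\<And>v. v \<in> {1..n} \<Longrightarrow> int (d v) = int (c v) + lap (ind A) v)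
    \<Longrightarrow> (fires_to n E)\<^sup>*\<^sup>* d c"
proof (induction "card A" arbitrary: A d)
  case 0
  then have "A = {}" using finite_subset by fastforce
  then have "lap (ind A) v = 0" for v by (simp add: lap_ind)
  then have "d v = c v" if "v \<in> {1..n}" for v using 0(4)[OF that] by simp
  moreover have "d v = c v" if "v \<notin> {1..n}" for v
    using c 0(2) that by (simp add: configs_def)
  ultimately have "d = c" by blast
  then show ?case by simp
next
  case (Suc k)
  then have "A \<noteq> {}" by auto
  then obtain i where i: "i \<in> A" "card (nbrs i \<inter> A) \<le> c i"
    using amp Suc(4) unfolding ample_def by blast
  have in1: "i \<in> {1..n}" using i Suc(4) by auto
  \<comment> \<open>In \<open>d\<close> the vertex \<open>i\<close> carries \<open>c i\<close> plus
    its degree minus the number of its neighbours in \<open>A\<close>; the choice of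
    \<open>i\<close> makes this at least the degree.\<close>
  have fireable: "can_fire n E d i"
    using Suc(5)[OF in1] i in1 by (simp add: can_fire_def degree_eq lap_ind)
  have "ind A = (\<lambda>v. ind (A - {i}) v + ind {i} v)"
    using i by (auto simp: ind_def)
  then have ind_split: "lap (ind A) v = lap (ind (A - {i})) v + lap (ind {i}) v" for v
    by (simp only: lap_add)
  have "(fires_to n E)\<^sup>*\<^sup>* (fire n E i d) c"
  proof (rule Suc(1))
    show "k = card (A - {i})" using Suc(2) i by simp
    show "fire n E i d \<in> configs n" using Suc(3) fireable by (rule fire_in_configs)
    show "A - {i} \<subseteq> {1..n}" using Suc(4) by auto
    show "int (fire n E i d v) = int (c v) + lap (ind (A - {i})) v" if "v \<in> {1..n}" for v
      using fire_eq_lap[OF fireable that] Suc(5)[OF that] ind_split[of v] by simp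
  qed
  moreover have "fires_to n E d (fire n E i d)" using fireable by (auto simp: fires_to_def)
  ultimately show ?case by (meson converse_rtranclp_into_rtranclp)
qed

text \<open>Firing the root adds \<open>lap (ind {1..n})\<close>, so burning can start with all
  non-root vertices unburnt and leads back to \<open>c\<close>.\<close>

lemma recurrent_configs_eq: "recurrent_configs n E = stable_ample"
proof -
  have "recurrent n E c" if "c \<in> stable_ample" for c
    using burning[of c "fire_root n E c" "{1..n}"] that fire_root_eq_lap fire_root_in_configs
    by (simp add: recurrent_def stable_ample_def)
  then show ?thesis
    using recurrent_imp_ample
    by (auto simp: recurrent_configs_def stable_ample_def recurrent_def)
qed

section \<open>The critical group as a quotient\<close>

lemma config_add_stable_ample:
  assumes "c \<in> stable_ample" "d \<in> stable_ample"
  shows "config_add n E c d \<in> stable_ample"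
    "fequiv (\<lambda>v. int (config_add n E c d v)) (\<lambda>v. int (c v) + int (d v))"
proof -
  have "(\<lambda>v. c v + d v) \<in> configs n" "ample {1..n} (\<lambda>v. c v + d v)"
    using assms ample_mono[of "{1..n}" c "\<lambda>v. c v + d v"]
    by (auto simp: stable_ample_def configs_def)
  from stabilization_stable_ample[OF this]
  show "config_add n E c d \<in> stable_ample"
    "fequiv (\<lambda>v. int (config_add n E c d v)) (\<lambda>v. int (c v) + int (d v))"
    by (simp_all add: config_add_def)
qed

text \<open>\<open>\<psi>\<close> presents \<open>G\<close> as the integer functions modulo
  \<open>fequiv\<close>. Each class contains exactly one recurrent configuration, so restricting
  \<open>\<psi>\<close> to these gives a bijection along which the group structure is
  transported.\<close>

lemma critical_group_iso:
  fixes G (structure)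
  assumes "group G"
    and closed: "\<And>x. \<psi> x \<in> carrier G"
    and add: "\<And>x y. \<psi> (\<lambda>v. x v + y v) = \<psi> x \<otimes> \<psi> y"
    and surj: "\<And>q. q \<in> carrier G \<Longrightarrow> \<exists>x. \<psi> x = q"
    and ker: "\<And>x y. \<psi> x = \<psi> y \<longleftrightarrow> fequiv x y"
  shows "group (critical_group n E)" "critical_group n E \<cong> G"
proof -
  interpret group G by fact
  define \<phi> where "\<phi> c = \<psi> (\<lambda>v. int (c v))" for c :: "nat \<Rightarrow> nat"
  let ?K = "critical_group n E"
  have carr: "carrier ?K = stable_ample" and mult: "mult ?K = config_add n E"
    by (simp_all add: critical_group_def recurrent_configs_eq)
  have inj: "c = d" if "\<phi> c = \<phi> d" "c \<in> stable_ample" "d \<in> stable_ample" for c d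
    using stable_ample_eqI[OF that(2,3)] that(1) by (simp add: \<phi>_def ker)
  have hom: "\<phi> (config_add n E c d) = \<phi> c \<otimes> \<phi> d"
    if "c \<in> stable_ample" "d \<in> stable_ample" for c d
    using config_add_stable_ample(2)[OF that] by (simp add: \<phi>_def ker flip: add)
  have onto: "\<exists>c\<in>stable_ample. \<phi> c = q" if q: "q \<in> carrier G" for q
  proof -
    obtain x where x: "\<psi> x = q" using surj[OF q] by blast
    obtain c where "c \<in> stable_ample" "fequiv (\<lambda>v. int (c v)) x" by (rule stable_ample_representative)
    with x show ?thesis unfolding \<phi>_def ker[symmetric] by blast
  qed
  have \<phi>_closed: "\<phi> c \<in> carrier G" for c by (simp add: \<phi>_def closed)
  have "inj_on \<phi> stable_ample" by (intro inj_onI inj)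
  then have bij: "bij_betw \<phi> stable_ample (carrier G)"
    using onto \<phi>_closed unfolding bij_betw_def by blast
  obtain e where e: "e \<in> stable_ample" "\<phi> e = \<one>" using onto[of \<one>] by auto
  \<comment> \<open>The description of the unit is resolved by the representative \<open>e\<close>
    of the trivial class: any other left unit maps to \<open>\<one>\<close> by cancellation in
    \<open>G\<close> and so equals \<open>e\<close>.\<close>
  have "one ?K = e"
    unfolding critical_group_def monoid.simps recurrent_configs_eq
  proof (rule the_equality)
    show "e \<in> stable_ample \<and> (\<forall>c\<in>stable_ample. config_add n E e c = c)"
    proof (intro conjI ballI inj)
      fix c assume c: "c \<in> stable_ample"
      show "\<phi> (config_add n E e c) = \<phi> c" using hom[OF e(1) c] e(2) \<phi>_closed by simp
    qed (use e config_add_stable_ample(1)[OF e(1)] in simp_all)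
    fix e' assume e': "e' \<in> stable_ample \<and> (\<forall>c\<in>stable_ample. config_add n E e' c = c)"
    then have "\<phi> e' \<otimes> \<phi> e = \<phi> e" using hom[of e' e] e by simp
    then show "e' = e"
      using e e' \<phi>_closed by (intro inj) simp_all
  qed
  with e have one: "one ?K \<in> carrier ?K" "\<phi> (one ?K) = \<one>" by (simp_all add: carr)
  have "bij_betw \<phi> (carrier ?K) (carrier G)" by (simp add: carr bij)
  moreover have "\<phi> (c \<otimes>\<^bsub>?K\<^esub> d) = \<phi> c \<otimes> \<phi> d" "c \<otimes>\<^bsub>?K\<^esub> d \<in> carrier ?K"
    if "c \<in> carrier ?K" "d \<in> carrier ?K" for c d
    using that by (simp_all add: carr mult hom config_add_stable_ample)
  ultimately show "group ?K" "?K \<cong> G"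
    using group_of_bij[of \<phi> ?K] one by simp_all
qed

end

section \<open>Integral duality\<close>

lemma mat_eqI_mult_vec:
  fixes A B :: "'a :: comm_semiring_1 mat"
  assumes A: "A \<in> carrier_mat nr nc" and B: "B \<in> carrier_mat nr nc"
    and eq: "\<And>x. x \<in> carrier_vec nc \<Longrightarrow> A *\<^sub>v x = B *\<^sub>v x"
  shows "A = B"
proof (rule eq_matI)
  fix i j assume "i < dim_row B" "j < dim_col B"
  then have ij: "i < nr" "j < nc" using B by auto
  have "(A *\<^sub>v unit_vec nc j) $ i = (B *\<^sub>v unit_vec nc j) $ i"
    by (simp add: eq)
  then show "A $$ (i, j) = B $$ (i, j)"
    using A B ij by simp
qed (use A B in auto)

lemma zero_mat_mult_vec [simp]:
  "v \<in> carrier_vec nc \<Longrightarrow> 0\<^sub>m nr nc *\<^sub>v v = (0\<^sub>v nr :: 'a :: semiring_0 vec)"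
  by (intro eq_vecI) auto

lemma mult_mat_zero_vec:
  "A \<in> carrier_mat nr nc \<Longrightarrow> A *\<^sub>v 0\<^sub>v nc = (0\<^sub>v nr :: 'a :: semiring_0 vec)"
  by (intro eq_vecI) auto

lemma vec_diff_eq_zeroD:
  fixes x y :: "'a :: group_add vec"
  assumes x: "x \<in> carrier_vec n" and y: "y \<in> carrier_vec n" and eq: "x - y = 0\<^sub>v n"
  shows "x = y"
proof (rule eq_vecI)
  fix i assume i: "i < dim_vec y"
  have "(x - y) $ i = 0" unfolding eq using i y by simp
  then show "x $ i = y $ i" using i by simp
qed (use x y in auto)

lemma vec_diff_eqI:
  fixes x y :: "'a :: ab_group_add vec"
  assumes x: "x \<in> carrier_vec n" and y: "y \<in> carrier_vec n" and eq: "x + y = z"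
  shows "z - x = y"
  unfolding eq[symmetric] by (rule eq_vecI) (use x y in auto)

lemma vec_eq_zero_iff: "x \<in> carrier_vec n \<Longrightarrow> x = 0\<^sub>v n \<longleftrightarrow> (\<forall>i<n. x $ i = 0)"
  by (auto intro!: eq_vecI)

lemma trace_mult_comm:
  fixes A B :: "'a :: comm_semiring_0 mat"
  assumes A: "A \<in> carrier_mat m k" and B: "B \<in> carrier_mat k m"
  shows "(\<Sum>i<m. (A * B) $$ (i, i)) = (\<Sum>i<k. (B * A) $$ (i, i))"
proof -
  have "(\<Sum>i<m. (A * B) $$ (i, i)) = (\<Sum>i<m. \<Sum>j<k. A $$ (i, j) * B $$ (j, i))"
    using A B by (intro sum.cong) (auto simp: scalar_prod_def lessThan_atLeast0)
  also have "\<dots> = (\<Sum>j<k. \<Sum>i<m. B $$ (j, i) * A $$ (i, j))"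
    by (subst sum.swap) (simp add: mult.commute)
  also have "\<dots> = (\<Sum>i<k. (B * A) $$ (i, i))"
    using A B by (intro sum.cong) (auto simp: scalar_prod_def lessThan_atLeast0)
  finally show ?thesis .
qed

section \<open>Split exact sequences of lattices and their duals\<close>

text \<open>A short exact sequence from Z^k by \<open>B\<close> to Z^m and by \<open>D\<close> onto
  Z^n, split by \<open>S\<close>. In the application \<open>B\<close> is the matrix of basis flows
  and \<open>D\<close> the reduced incidence matrix.\<close>

locale split_exact =
  fixes n m k :: nat and D S B :: "int mat"
  assumes D: "D \<in> carrier_mat n m" and S: "S \<in> carrier_mat m n" and B: "B \<in> carrier_mat m k"
    and DS: "D * S = 1\<^sub>m n"
    and DB: "D * B = 0\<^sub>m n k"
    and exact: "\<And>x. x \<in> carrier_vec m \<Longrightarrow> D *\<^sub>v x = 0\<^sub>v n \<Longrightarrow> \<exists>y\<in>carrier_vec k. x = B *\<^sub>v y"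
    and inj: "\<And>y. y \<in> carrier_vec k \<Longrightarrow> B *\<^sub>v y = 0\<^sub>v m \<Longrightarrow> y = 0\<^sub>v k"
begin

text \<open>Exactness writes \<open>u - S D u\<close> as \<open>B r\<close> for each unit vector
  \<open>u\<close>, and these \<open>r\<close> are the columns of \<open>R\<close>. Applying the
  resulting decomposition to \<open>B y\<close>, where the \<open>S D\<close> term dies, gives
  \<open>B R B y = B y\<close>, and injectivity of \<open>B\<close> cancels.\<close>

lemma retraction:
  obtains R where "R \<in> carrier_mat k m" "B * R + S * D = 1\<^sub>m m" "R * B = 1\<^sub>m k"
proof -
  have "\<exists>y\<in>carrier_vec k. unit_vec m j - S *\<^sub>v (D *\<^sub>v unit_vec m j) = B *\<^sub>v y" for j
  proof (rule exact)
    have u: "unit_vec m j \<in> carrier_vec m" by simp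
    have Du: "D *\<^sub>v unit_vec m j \<in> carrier_vec n" using D by simp
    have "D *\<^sub>v (S *\<^sub>v (D *\<^sub>v unit_vec m j)) = D *\<^sub>v unit_vec m j"
      using DS Du by (subst assoc_mult_mat_vec[OF D S Du, symmetric]) simp
    then show "D *\<^sub>v (unit_vec m j - S *\<^sub>v (D *\<^sub>v unit_vec m j)) = 0\<^sub>v n"
      using D S Du by (simp add: mult_minus_distrib_mat_vec[OF D u])
    show "unit_vec m j - S *\<^sub>v (D *\<^sub>v unit_vec m j) \<in> carrier_vec m"
      by (rule minus_carrier_vec[OF u]) (use S Du in simp)
  qed
  then obtain r where r: "\<And>j. r j \<in> carrier_vec k"
    "\<And>j. unit_vec m j - S *\<^sub>v (D *\<^sub>v unit_vec m j) = B *\<^sub>v r j"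
    unfolding Bex_def by (metis (no_types, lifting))
  define R where "R = mat_of_cols k (map r [0..<m])"
  have R: "R \<in> carrier_mat k m" by (simp add: R_def mat_of_cols_carrier(1)[where vs="map r [0..<m]", simplified])
  have colR: "col R j = r j" if "j < m" for j
    using that r(1) by (simp add: R_def)
  have sum1: "B * R + S * D = 1\<^sub>m m"
  proof (rule eq_matI)
    fix i j assume "i < dim_row (1\<^sub>m m :: int mat)" "j < dim_col (1\<^sub>m m :: int mat)"
    then have ij: "i < m" "j < m" by auto
    have e: "D *\<^sub>v unit_vec m j = col D j" using D ij by (intro eq_vecI) auto
    have "(B * R) $$ (i, j) = (B *\<^sub>v r j) $ i"
      using B R ij by (simp add: colR)
    also have "\<dots> = unit_vec m j $ i - (S * D) $$ (i, j)"
      unfolding r(2)[symmetric] e using S D ij by simp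
    finally show "(B * R + S * D) $$ (i, j) = 1\<^sub>m m $$ (i, j)"
      using S D B R ij by (simp add: unit_vec_def)
  qed (use S D B R in auto)
  have "R * B = 1\<^sub>m k"
  proof (rule mat_eqI_mult_vec)
    fix y :: "int vec" assume y: "y \<in> carrier_vec k"
    have By: "B *\<^sub>v y \<in> carrier_vec m" using B y by simp
    have RBy: "R *\<^sub>v (B *\<^sub>v y) \<in> carrier_vec k" using R By by simp
    have "B *\<^sub>v y = (B * R + S * D) *\<^sub>v (B *\<^sub>v y)" using By by (simp add: sum1)
    also have "\<dots> = B *\<^sub>v (R *\<^sub>v (B *\<^sub>v y)) + S *\<^sub>v (D *\<^sub>v (B *\<^sub>v y))"
      using B R S D By by (simp add: add_mult_distrib_mat_vec[of _ m m])
    also have "D *\<^sub>v (B *\<^sub>v y) = 0\<^sub>v n"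
      using DB B D y by (subst assoc_mult_mat_vec[OF D B y, symmetric]) auto
    finally have "B *\<^sub>v (R *\<^sub>v (B *\<^sub>v y)) = B *\<^sub>v y"
      using mult_mat_zero_vec[OF S] B RBy by simp
    then have "B *\<^sub>v (R *\<^sub>v (B *\<^sub>v y) - y) = 0\<^sub>v m"
      using By by (simp add: mult_minus_distrib_mat_vec[OF B RBy y])
    then have "R *\<^sub>v (B *\<^sub>v y) - y = 0\<^sub>v k" by (rule inj[rotated]) (use y RBy in auto)
    then have "R *\<^sub>v (B *\<^sub>v y) = y" by (rule vec_diff_eq_zeroD[OF RBy y])
    then show "(R * B) *\<^sub>v y = 1\<^sub>m k *\<^sub>v y" using R B y by simp
  qed (use R B in auto)
  with R sum1 show thesis by (rule that)
qed

text \<open>Take traces in \<open>B R + S D = 1\<close>.\<close>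

lemma rank_eq: "m = k + n"
proof -
  obtain R where R: "R \<in> carrier_mat k m" "B * R + S * D = 1\<^sub>m m" "R * B = 1\<^sub>m k"
    by (rule retraction)
  have "int m = (\<Sum>i<m. (1\<^sub>m m :: int mat) $$ (i, i))" by simp
  also have "\<dots> = (\<Sum>i<m. (B * R) $$ (i, i) + (S * D) $$ (i, i))"
    unfolding R(2)[symmetric] using B R(1) S D by (intro sum.cong refl index_add_mat) auto
  also have "\<dots> = (\<Sum>i<k. (R * B) $$ (i, i)) + (\<Sum>i<n. (D * S) $$ (i, i))"
    by (simp only: sum.distrib trace_mult_comm[OF B R(1)] trace_mult_comm[OF S D])
  also have "\<dots> = int k + int n" by (simp add: R(3) DS)
  finally show ?thesis by simp
qed

text \<open>Over the integers the kernel of \<open>B\<^sup>T\<close> is exactly the image of \<open>D\<^sup>T\<close>, by transposing \<open>B R + S D = 1\<close>.\<close>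

lemma
  shows dual_quotient: "\<And>c. c \<in> carrier_vec n \<Longrightarrow>
      (\<exists>y\<in>carrier_vec k. B\<^sup>T *\<^sub>v (S *\<^sub>v c) = (B\<^sup>T * B) *\<^sub>v y) \<longleftrightarrow>
      (\<exists>z\<in>carrier_vec n. c = D *\<^sub>v (D\<^sup>T *\<^sub>v z))"
    and dual_quotient_surj:
    "\<And>y. y \<in> carrier_vec k \<Longrightarrow>
      \<exists>c\<in>carrier_vec n. \<exists>w\<in>carrier_vec k. y = B\<^sup>T *\<^sub>v (S *\<^sub>v c) + (B\<^sup>T * B) *\<^sub>v w"
proof -
  obtain R where R: "R \<in> carrier_mat k m" and BR: "B * R + S * D = 1\<^sub>m m" and RB: "R * B = 1\<^sub>m k"
    by (rule retraction)
  have T: "B\<^sup>T \<in> carrier_mat k m" "R\<^sup>T \<in> carrier_mat m k" "D\<^sup>T \<in> carrier_mat m n" "S\<^sup>T \<in> carrier_mat n m"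
    using B R D S by auto
  have decomp: "B *\<^sub>v (R *\<^sub>v x) + S *\<^sub>v (D *\<^sub>v x) = x" if "x \<in> carrier_vec m" for x
  proof -
    have "(B * R + S * D) *\<^sub>v x = x" using that BR by simp
    then show ?thesis using that B R S D by (simp add: add_mult_distrib_mat_vec[of _ m m])
  qed
  have "R\<^sup>T * B\<^sup>T + D\<^sup>T * S\<^sup>T = (B * R + S * D)\<^sup>T"
    using B R S D by (simp add: transpose_add[of _ m m] transpose_mult[of _ m k _ m] transpose_mult[of _ m n _ m])
  then have BRt: "R\<^sup>T * B\<^sup>T + D\<^sup>T * S\<^sup>T = 1\<^sub>m m" by (simp add: BR)
  have decompt: "R\<^sup>T *\<^sub>v (B\<^sup>T *\<^sub>v x) + D\<^sup>T *\<^sub>v (S\<^sup>T *\<^sub>v x) = x" if "x \<in> carrier_vec m" for x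
  proof -
    have "(R\<^sup>T * B\<^sup>T + D\<^sup>T * S\<^sup>T) *\<^sub>v x = x" using that BRt by simp
    then show ?thesis using that T by (simp add: add_mult_distrib_mat_vec[of _ m m])
  qed
  have "B\<^sup>T * R\<^sup>T = (R * B)\<^sup>T" using R B by (simp add: transpose_mult[of _ k m _ k])
  then have RBt: "B\<^sup>T *\<^sub>v (R\<^sup>T *\<^sub>v y) = y" if "y \<in> carrier_vec k" for y
    using that T RB assoc_mult_mat_vec[OF T(1,2) that] by simp
  have "B\<^sup>T * D\<^sup>T = (D * B)\<^sup>T" using D B by (simp add: transpose_mult[of _ n m _ k])
  also have "\<dots> = 0\<^sub>m k n" by (simp add: DB)
  finally have BDt: "B\<^sup>T *\<^sub>v (D\<^sup>T *\<^sub>v z) = 0\<^sub>v k" if "z \<in> carrier_vec n" for z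
    using that assoc_mult_mat_vec[OF T(1,3) that] by simp
  have DSv: "D *\<^sub>v (S *\<^sub>v x) = x" if "x \<in> carrier_vec n" for x
    using that DS assoc_mult_mat_vec[OF D S that] by simp
  have DBv: "D *\<^sub>v (B *\<^sub>v y) = 0\<^sub>v n" if "y \<in> carrier_vec k" for y
    using that DB assoc_mult_mat_vec[OF D B that] by auto
  have BBv: "(B\<^sup>T * B) *\<^sub>v y = B\<^sup>T *\<^sub>v (B *\<^sub>v y)" if "y \<in> carrier_vec k" for y
    using assoc_mult_mat_vec[OF T(1) B that] .
  show "(\<exists>y\<in>carrier_vec k. B\<^sup>T *\<^sub>v (S *\<^sub>v c) = (B\<^sup>T * B) *\<^sub>v y) \<longleftrightarrow>
      (\<exists>z\<in>carrier_vec n. c = D *\<^sub>v (D\<^sup>T *\<^sub>v z))" (is "?L \<longleftrightarrow> ?R")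
    if c: "c \<in> carrier_vec n" for c
  proof
    have Sc: "S *\<^sub>v c \<in> carrier_vec m" using S c by simp
    assume ?L
    then obtain y where y: "y \<in> carrier_vec k" "B\<^sup>T *\<^sub>v (S *\<^sub>v c) = B\<^sup>T *\<^sub>v (B *\<^sub>v y)"
      by (auto simp: BBv)
    have By: "B *\<^sub>v y \<in> carrier_vec m" using B y by simp
    \<comment> \<open>\<open>B\<^sup>T\<close> kills \<open>q\<close>, so the transposed
      decomposition exhibits \<open>q\<close> as \<open>D\<^sup>T\<close> applied to
      \<open>S\<^sup>T q\<close>; moreover \<open>D q = c\<close>, since \<open>D S = 1\<close> and
      \<open>D B = 0\<close>.\<close>
    define q where "q = S *\<^sub>v c - B *\<^sub>v y"
    have q: "q \<in> carrier_vec m" using Sc By by (simp add: q_def)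
    have "B\<^sup>T *\<^sub>v q = 0\<^sub>v k"
      unfolding q_def using y T by (simp add: mult_minus_distrib_mat_vec[OF T(1) Sc By])
    then have "D\<^sup>T *\<^sub>v (S\<^sup>T *\<^sub>v q) = q"
      using decompt[OF q] mult_mat_zero_vec[OF T(2)] mult_mat_vec_carrier[OF T(3), of "S\<^sup>T *\<^sub>v q"] T q
      by simp
    moreover have "D *\<^sub>v q = c"
      unfolding q_def using c y by (simp add: mult_minus_distrib_mat_vec[OF D Sc By] DSv DBv)
    ultimately show ?R using T q by (intro bexI[of _ "S\<^sup>T *\<^sub>v q"]) auto
  next
    assume ?R
    then obtain z where z: "z \<in> carrier_vec n" "c = D *\<^sub>v (D\<^sup>T *\<^sub>v z)" by blast
    \<comment> \<open>The decomposition gives \<open>S c = S D p = p - B R p\<close>, and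
      \<open>B\<^sup>T\<close> kills \<open>p\<close>, so the preimage is
      \<open>- (R p)\<close>.\<close>
    define p where "p = D\<^sup>T *\<^sub>v z"
    have p: "p \<in> carrier_vec m" using T z by (simp add: p_def)
    have Rp: "R *\<^sub>v p \<in> carrier_vec k" "- (R *\<^sub>v p) \<in> carrier_vec k" using R p by auto
    have BRp: "B *\<^sub>v (R *\<^sub>v p) \<in> carrier_vec m" using B Rp by simp
    have "B\<^sup>T *\<^sub>v (S *\<^sub>v c) = B\<^sup>T *\<^sub>v (p - B *\<^sub>v (R *\<^sub>v p))"
    proof -
      have "p - B *\<^sub>v (R *\<^sub>v p) = S *\<^sub>v (D *\<^sub>v p)"
        by (rule vec_diff_eqI[OF BRp _ decomp[OF p]]) (use S D p in auto)
      then show ?thesis using z by (simp add: p_def)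
    qed
    also have "\<dots> = - (B\<^sup>T *\<^sub>v (B *\<^sub>v (R *\<^sub>v p)))"
    proof -
      have "B\<^sup>T *\<^sub>v p = 0\<^sub>v k" using BDt[OF z(1)] by (simp add: p_def)
      then show ?thesis using T BRp by (simp add: mult_minus_distrib_mat_vec[OF T(1) p BRp])
    qed
    also have "\<dots> = (B\<^sup>T * B) *\<^sub>v (- (R *\<^sub>v p))"
    proof -
      have "(B\<^sup>T * B) *\<^sub>v (0\<^sub>v k - R *\<^sub>v p) = (B\<^sup>T * B) *\<^sub>v 0\<^sub>v k - (B\<^sup>T * B) *\<^sub>v (R *\<^sub>v p)"
        by (rule mult_minus_distrib_mat_vec[of _ k k]) (use T B Rp in auto)
      then show ?thesis
        using Rp T B by (simp add: BBv mult_mat_zero_vec[OF B] mult_mat_zero_vec[OF T(1)])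
    qed
    finally show ?L using Rp by blast
  qed
  fix y :: "int vec" assume y: "y \<in> carrier_vec k"
  \<comment> \<open>A preimage of \<open>y\<close> under \<open>B\<^sup>T\<close>, by transposing
    \<open>R B = 1\<close>. Its \<open>B R\<close> part falls into the image of
    \<open>B\<^sup>T B\<close>, and its \<open>S D\<close> part has the required form.\<close>
  define x where "x = R\<^sup>T *\<^sub>v y"
  have x: "x \<in> carrier_vec m" using T y by (simp add: x_def)
  have car: "R *\<^sub>v x \<in> carrier_vec k" "D *\<^sub>v x \<in> carrier_vec n"
    "B *\<^sub>v (R *\<^sub>v x) \<in> carrier_vec m" "S *\<^sub>v (D *\<^sub>v x) \<in> carrier_vec m"
    using R B D S x by auto
  have "y = B\<^sup>T *\<^sub>v x" using RBt[OF y] by (simp add: x_def)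
  also have "\<dots> = B\<^sup>T *\<^sub>v (B *\<^sub>v (R *\<^sub>v x) + S *\<^sub>v (D *\<^sub>v x))" by (simp add: decomp[OF x])
  also have "\<dots> = B\<^sup>T *\<^sub>v (B *\<^sub>v (R *\<^sub>v x)) + B\<^sup>T *\<^sub>v (S *\<^sub>v (D *\<^sub>v x))"
    by (rule mult_add_distrib_mat_vec[OF T(1) car(3,4)])
  also have "\<dots> = B\<^sup>T *\<^sub>v (S *\<^sub>v (D *\<^sub>v x)) + (B\<^sup>T * B) *\<^sub>v (R *\<^sub>v x)"
    unfolding BBv[OF car(1)] by (rule comm_add_vec[of _ k]) (use T car in auto)
  finally show "\<exists>c\<in>carrier_vec n. \<exists>w\<in>carrier_vec k. y = B\<^sup>T *\<^sub>v (S *\<^sub>v c) + (B\<^sup>T * B) *\<^sub>v w"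
    using car by blast
qed

end

section \<open>The incidence matrix\<close>

text \<open>Row \<open>i\<close> belongs to vertex \<open>i + 1\<close>, as the row of the root is
  deleted. For edges with distinct ends the entries agree with those of
  \<open>incidence_matrix\<close>.\<close>

definition reduced_incidence :: "nat \<Rightarrow> (nat \<times> nat) list \<Rightarrow> int mat" where
  "reduced_incidence n es = mat n (length es)
     (\<lambda>(i, j). of_bool (i + 1 = snd (es ! j)) - of_bool (i + 1 = fst (es ! j)))"

lemma reduced_incidence_carrier [simp]: "reduced_incidence n es \<in> carrier_mat n (length es)"
  by (simp add: reduced_incidence_def)

lemma reduced_incidence_dim [simp]:
  "dim_row (reduced_incidence n es) = n" "dim_col (reduced_incidence n es) = length es"
  by (simp_all add: reduced_incidence_def)

locale oriented_graph = rooted_graph +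
  fixes es :: "(nat \<times> nat) list"
  assumes orientation: "orientation E es"
begin

abbreviation "D \<equiv> reduced_incidence n es"

lemma edge_iff: "{u, v} \<in> E \<longleftrightarrow> (u, v) \<in> set es \<or> (v, u) \<in> set es"
proof -
  have "E = (\<lambda>(u, v). {u, v}) ` set es" using orientation by (auto simp: orientation_def)
  then have "{u, v} \<in> E \<longleftrightarrow> (\<exists>(a, b)\<in>set es. {u, v} = {a, b})" by auto
  then show ?thesis by (auto simp: doubleton_eq_iff)
qed

lemma card_edges: "card E = length es"
  using orientation distinct_card by (fastforce simp: orientation_def)

lemma distinct_es: "distinct es"
  using orientation by (auto simp: orientation_def distinct_map)

lemma antiparallel_free:
  assumes "(u, v) \<in> set es" shows "(v, u) \<notin> set es"
proof
  assume "(v, u) \<in> set es"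
  have "inj_on (\<lambda>(u, v). {u, v}) (set es)"
    using orientation by (auto simp: orientation_def distinct_map)
  then have "(u, v) = (v, u)"
    by (rule inj_onD) (use assms \<open>(v, u) \<in> set es\<close> in auto)
  moreover have "u \<noteq> v" using assms edge_bounds edge_iff by blast
  ultimately show False by simp
qed

lemma es_nth:
  assumes "j < length es"
  shows "fst (es ! j) \<le> n" "snd (es ! j) \<le> n" "fst (es ! j) \<noteq> snd (es ! j)"
proof -
  have "{fst (es ! j), snd (es ! j)} \<in> E" using assms by (simp add: edge_iff)
  from edge_bounds[OF this] show "fst (es ! j) \<le> n" "snd (es ! j) \<le> n" "fst (es ! j) \<noteq> snd (es ! j)" by auto
qed

text \<open>The row of the root is minus the sum of the other rows, so deleting it does not change the kernel.\<close>

lemma flow_lattice_eq: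
  "flow_lattice n es = {f \<in> carrier_vec (length es). D *\<^sub>v f = 0\<^sub>v n}"
proof -
  \<comment> \<open>The integral incidence matrix with the row of the root kept; both the real
    matrix and \<open>D\<close> are compared with it.\<close>
  define a where "a v j = (of_bool (v = snd (es ! j)) - of_bool (v = fst (es ! j)) :: int)" for v j
  have real_row: "(incidence_matrix n es *\<^sub>v map_vec real_of_int f) $ v
      = real_of_int (\<Sum>j<length es. a v j * f $ j)"
    if "f \<in> carrier_vec (length es)" "v < n + 1" for f v
  proof -
    have "(incidence_matrix n es *\<^sub>v map_vec real_of_int f) $ v
      = (\<Sum>j<length es. incidence_matrix n es $$ (v, j) * real_of_int (f $ j))"
      using that by (simp add: incidence_matrix_def scalar_prod_def lessThan_atLeast0)
    also have "\<dots> = (\<Sum>j<length es. real_of_int (a v j * f $ j))"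
    proof (rule sum.cong)
      fix j assume "j \<in> {..<length es}"
      then have "incidence_matrix n es $$ (v, j) = real_of_int (a v j)"
        using es_nth(3)[of j] that by (simp add: incidence_matrix_def a_def)
      then show "incidence_matrix n es $$ (v, j) * real_of_int (f $ j) = real_of_int (a v j * f $ j)"
        by simp
    qed simp
    finally show ?thesis by simp
  qed
  have int_row: "(D *\<^sub>v f) $ i = (\<Sum>j<length es. a (i + 1) j * f $ j)"
    if "f \<in> carrier_vec (length es)" "i < n" for f i
    using that by (simp add: reduced_incidence_def scalar_prod_def lessThan_atLeast0 a_def)
  have col_sum: "(\<Sum>v\<le>n. a v j) = 0" if "j < length es" for j
    using es_nth(1,2)[OF that] by (simp add: a_def sum_subtractf of_bool_def)
  have total: "(\<Sum>v\<le>n. \<Sum>j<length es. a v j * f $ j) = 0" for f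
  proof -
    have "(\<Sum>v\<le>n. \<Sum>j<length es. a v j * f $ j) = (\<Sum>j<length es. (\<Sum>v\<le>n. a v j) * f $ j)"
      unfolding sum_distrib_right by (rule sum.swap)
    also have "\<dots> = 0" by (rule sum.neutral) (simp add: col_sum)
    finally show ?thesis .
  qed
  have "incidence_matrix n es *\<^sub>v map_vec real_of_int f = 0\<^sub>v (n + 1) \<longleftrightarrow> D *\<^sub>v f = 0\<^sub>v n"
    if f: "f \<in> carrier_vec (length es)" for f
  proof -
    let ?r = "\<lambda>v. \<Sum>j<length es. a v j * f $ j"
    have "incidence_matrix n es *\<^sub>v map_vec real_of_int f = 0\<^sub>v (n + 1) \<longleftrightarrow>
        (\<forall>v<n + 1. (incidence_matrix n es *\<^sub>v map_vec real_of_int f) $ v = 0)"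
      by (intro vec_eq_zero_iff carrier_vecI) (simp only: dim_mult_mat_vec incidence_matrix_def dim_row_mat)
    also have "\<dots> \<longleftrightarrow> (\<forall>v<n + 1. ?r v = 0)"
      by (intro all_cong) (simp only: real_row[OF f] of_int_eq_0_iff)
    also have "\<dots> \<longleftrightarrow> (\<forall>i<n. ?r (i + 1) = 0)"
    proof
      assume *: "\<forall>i<n. ?r (i + 1) = 0"
      have "?r 0 + (\<Sum>i<n. ?r (i + 1)) = 0"
        using total[of f] by (simp add: sum.atMost_shift)
      with * have "?r 0 = 0" by simp
      show "\<forall>v<n + 1. ?r v = 0"
      proof (intro allI impI)
        fix v assume "v < n + 1"
        then show "?r v = 0" using * \<open>?r 0 = 0\<close> by (cases v) auto
      qed
    qed auto
    also have "\<dots> \<longleftrightarrow> (\<forall>i<n. (D *\<^sub>v f) $ i = 0)"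
      by (intro all_cong) (simp only: int_row[OF f])
    also have "\<dots> \<longleftrightarrow> D *\<^sub>v f = 0\<^sub>v n"
      by (rule vec_eq_zero_iff[symmetric]) (simp add: carrier_vecI)
    finally show ?thesis .
  qed
  then show ?thesis by (auto simp: flow_lattice_def)
qed

section \<open>An integral section of the reduced incidence matrix\<close>

definition vertex_vec :: "nat \<Rightarrow> int vec" where
  "vertex_vec v = vec n (\<lambda>i. of_bool (i + 1 = v))"

text \<open>A path from the root to \<open>v\<close>, as a signed sum of edges, has boundary \<open>v\<close>; the vector of the root is zero.\<close>

lemma path_vec_exists:
  assumes "v \<le> n"
  shows "\<exists>s\<in>carrier_vec (length es). D *\<^sub>v s = vertex_vec v"
proof -
  have "(0, v) \<in> {(a, b). {a, b} \<in> E}\<^sup>*"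
    using connected assms by (auto simp: connected_graph_def)
  then show ?thesis
  proof (induction rule: rtrancl_induct)
    case base
    have "D *\<^sub>v 0\<^sub>v (length es) = vertex_vec 0"
      by (rule eq_vecI) (auto simp: reduced_incidence_def vertex_vec_def)
    then show ?case by (intro bexI[of _ "0\<^sub>v (length es)"]) auto
  next
    case (step u v)
    then obtain s where s: "s \<in> carrier_vec (length es)" "D *\<^sub>v s = vertex_vec u" by blast
    have col: "D *\<^sub>v unit_vec (length es) j = vertex_vec (snd (es ! j)) - vertex_vec (fst (es ! j))"
      if "j < length es" for j
      using that by (intro eq_vecI) (auto simp: reduced_incidence_def vertex_vec_def)
    \<comment> \<open>The unit vector of the new edge is added if the path follows its orientation
      and subtracted otherwise.\<close>
    have "(u, v) \<in> set es \<or> (v, u) \<in> set es" using step by (simp add: edge_iff)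
    then show ?case
    proof
      assume "(u, v) \<in> set es"
      then obtain j where j: "j < length es" "es ! j = (u, v)" by (auto simp: in_set_conv_nth)
      have "D *\<^sub>v (s + unit_vec (length es) j) = vertex_vec v"
        using col[OF j(1)] j s
        by (simp add: mult_add_distrib_mat_vec[of _ n "length es"]) (auto simp: vertex_vec_def)
      then show ?thesis using s by (intro bexI[of _ "s + unit_vec (length es) j"]) auto
    next
      assume "(v, u) \<in> set es"
      then obtain j where j: "j < length es" "es ! j = (v, u)" by (auto simp: in_set_conv_nth)
      have "D *\<^sub>v (s - unit_vec (length es) j) = vertex_vec v"
        using col[OF j(1)] j s
        by (simp add: mult_minus_distrib_mat_vec[of _ n "length es"]) (auto simp: vertex_vec_def)
      then show ?thesis using s by (intro bexI[of _ "s - unit_vec (length es) j"]) auto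
    qed
  qed
qed

lemma section_exists:
  obtains S where "S \<in> carrier_mat (length es) n" "D * S = 1\<^sub>m n"
proof -
  obtain s where s: "\<And>v. v \<le> n \<Longrightarrow> s v \<in> carrier_vec (length es)"
    "\<And>v. v \<le> n \<Longrightarrow> D *\<^sub>v s v = vertex_vec v"
    using path_vec_exists by metis
  \<comment> \<open>Column \<open>i\<close> is a path to vertex \<open>i + 1\<close>, matching the
    numbering of the rows of \<open>D\<close>.\<close>
  define S where "S = mat_of_cols (length es) (map (\<lambda>i. s (i + 1)) [0..<n])"
  have S: "S \<in> carrier_mat (length es) n"
    using mat_of_cols_carrier(1)[of "length es" "map (\<lambda>i. s (i + 1)) [0..<n]"] by (simp add: S_def)
  have "D * S = 1\<^sub>m n"
  proof (rule eq_matI)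
    fix i j assume "i < dim_row (1\<^sub>m n :: int mat)" "j < dim_col (1\<^sub>m n :: int mat)"
    then have ij: "i < n" "j < n" by auto
    then have "col S j = s (j + 1)" using s(1)[of "j + 1"] by (simp add: S_def)
    then have "(D * S) $$ (i, j) = (D *\<^sub>v s (j + 1)) $ i"
      using S ij by simp
    also have "D *\<^sub>v s (j + 1) = vertex_vec (j + 1)" using s(2) ij by simp
    finally show "(D * S) $$ (i, j) = 1\<^sub>m n $$ (i, j)"
      using ij by (simp add: vertex_vec_def)
  qed (use S in auto)
  with S show thesis by (rule that)
qed

section \<open>The Laplacian as a product of incidence matrices\<close>

text \<open>Each neighbour of \<open>v\<close> is joined to it by exactly one listed pair, either
  incoming or outgoing; \<open>antiparallel_free\<close> excludes both at once.\<close>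

lemma sum_edges_at:
  fixes F :: "nat \<Rightarrow> int"
  shows "(\<Sum>(a, b)\<in>set es. of_bool (v = b) * F a + of_bool (v = a) * F b) = (\<Sum>w\<in>nbrs v. F w)"
proof -
  let ?I = "{a. (a, v) \<in> set es}" and ?O = "{b. (v, b) \<in> set es}"
  have fin: "finite ?I" "finite ?O"
    by (rule finite_subset[of _ "fst ` set es"], force, simp)
       (rule finite_subset[of _ "snd ` set es"], force, simp)
  have "(\<Sum>(a, b)\<in>set es. of_bool (v = b) * F a) = (\<Sum>e\<in>(\<lambda>a. (a, v)) ` ?I. F (fst e))"
    by (rule sum.mono_neutral_cong_right) auto
  also have "\<dots> = (\<Sum>a\<in>?I. F a)" by (subst sum.reindex) (auto simp: inj_on_def)
  finally have I: "(\<Sum>(a, b)\<in>set es. of_bool (v = b) * F a) = (\<Sum>a\<in>?I. F a)" .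
  have "(\<Sum>(a, b)\<in>set es. of_bool (v = a) * F b) = (\<Sum>e\<in>(\<lambda>b. (v, b)) ` ?O. F (snd e))"
    by (rule sum.mono_neutral_cong_right) auto
  also have "\<dots> = (\<Sum>b\<in>?O. F b)" by (subst sum.reindex) (auto simp: inj_on_def)
  finally have O: "(\<Sum>(a, b)\<in>set es. of_bool (v = a) * F b) = (\<Sum>b\<in>?O. F b)" .
  have "nbrs v = ?I \<union> ?O" by (auto simp: nbrs_def edge_iff)
  moreover have "?I \<inter> ?O = {}" using antiparallel_free by auto
  ultimately have "(\<Sum>w\<in>nbrs v. F w) = (\<Sum>a\<in>?I. F a) + (\<Sum>b\<in>?O. F b)"
    using fin by (simp add: sum.union_disjoint)
  then show ?thesis
    unfolding I[symmetric] O[symmetric] by (simp only: sum.distrib case_prod_unfold)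
qed

text \<open>\<open>D\<^sup>T\<close> turns the potential \<open>f\<close>, which extends
  \<open>z\<close> by 0 at the root, into its differences along the edges, and \<open>D\<close>
  collects these at each vertex.\<close>

lemma incidence_laplacian:
  assumes z: "z \<in> carrier_vec n" and i: "i < n"
    and f: "f 0 = 0" "\<And>i. i < n \<Longrightarrow> f (i + 1) = z $ i"
  shows "(D *\<^sub>v (D\<^sup>T *\<^sub>v z)) $ i = lap f (i + 1)"
proof -
  \<comment> \<open>For the root no index matches and the sum is empty, in agreement with
    \<open>f 0 = 0\<close>.\<close>
  have pick: "(\<Sum>i<n. of_bool (i + 1 = v) * z $ i) = f v" if "v \<le> n" for v
  proof (cases v)
    case (Suc v')
    then have "(\<Sum>i<n. of_bool (i + 1 = v) * z $ i) = (\<Sum>i<n. if i = v' then z $ i else 0)"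
      by (intro sum.cong) auto
    then show ?thesis using Suc that f(2)[of v'] by simp
  qed (simp add: f)
  define p where "p = D\<^sup>T *\<^sub>v z"
  have dim_p: "dim_vec p = length es" by (simp add: p_def)
  have pot: "p $ j = f (snd (es ! j)) - f (fst (es ! j))" if "j < length es" for j
  proof -
    have "p $ j
      = (\<Sum>i<n. of_bool (i + 1 = snd (es ! j)) * z $ i - of_bool (i + 1 = fst (es ! j)) * z $ i)"
      using that z by (auto simp: p_def reduced_incidence_def scalar_prod_def lessThan_atLeast0
          left_diff_distrib intro!: sum.cong)
    then show ?thesis
      using that by (simp only: sum_subtractf pick es_nth)
  qed
  let ?v = "i + 1"
  have "(D *\<^sub>v (D\<^sup>T *\<^sub>v z)) $ i = (\<Sum>j<length es. D $$ (i, j) * p $ j)"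
    unfolding p_def[symmetric] using i by (simp add: scalar_prod_def lessThan_atLeast0 dim_p)
  \<comment> \<open>An incoming edge has sign 1 and an outgoing one sign -1. The sign also reverses
    the difference, so both kinds give the value at this vertex minus the value at the other
    end.\<close>
  also have "\<dots> = (\<Sum>j<length es. case es ! j of (a, b) \<Rightarrow>
      of_bool (?v = b) * (f ?v - f a) + of_bool (?v = a) * (f ?v - f b))"
    by (rule sum.cong) (use i es_nth pot in \<open>auto simp: reduced_incidence_def case_prod_unfold\<close>)
  also have "\<dots> = (\<Sum>(a, b)\<in>set es. of_bool (?v = b) * (f ?v - f a) + of_bool (?v = a) * (f ?v - f b))"
    by (rule sum.reindex_bij_betw[OF bij_betw_nth[OF distinct_es refl refl]])
  also have "\<dots> = lap f ?v" unfolding lap_def by (rule sum_edges_at)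
  finally show ?thesis .
qed

lemma fequiv_iff_incidence:
  "fequiv x y \<longleftrightarrow>
    (\<exists>z\<in>carrier_vec n. vec n (\<lambda>i. x (i + 1) - y (i + 1)) = D *\<^sub>v (D\<^sup>T *\<^sub>v z))"
proof
  show "\<exists>z\<in>carrier_vec n. vec n (\<lambda>i. x (i + 1) - y (i + 1)) = D *\<^sub>v (D\<^sup>T *\<^sub>v z)"
    if eq: "fequiv x y"
  proof -
    from eq obtain f where f: "f 0 = 0" "\<And>v. v \<in> {1..n} \<Longrightarrow> x v - y v = lap f v"
      by (auto simp: fequiv_def)
    let ?z = "vec n (\<lambda>i. f (i + 1))"
    have "vec n (\<lambda>i. x (i + 1) - y (i + 1)) = D *\<^sub>v (D\<^sup>T *\<^sub>v ?z)"
    proof (rule eq_vecI)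
      fix i assume "i < dim_vec (D *\<^sub>v (D\<^sup>T *\<^sub>v ?z))"
      then have i: "i < n" by simp
      show "vec n (\<lambda>i. x (i + 1) - y (i + 1)) $ i = (D *\<^sub>v (D\<^sup>T *\<^sub>v ?z)) $ i"
        using f(2)[of "i + 1"] i by (subst incidence_laplacian[of ?z i f]) (auto simp: f(1))
    qed simp
    then show ?thesis by (intro bexI[of _ ?z]) auto
  qed
  assume "\<exists>z\<in>carrier_vec n. vec n (\<lambda>i. x (i + 1) - y (i + 1)) = D *\<^sub>v (D\<^sup>T *\<^sub>v z)"
  then obtain z where z: "z \<in> carrier_vec n"
    "vec n (\<lambda>i. x (i + 1) - y (i + 1)) = D *\<^sub>v (D\<^sup>T *\<^sub>v z)" by blast
  define f where "f v = (if v = 0 then 0 else z $ (v - 1))" for v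
  have "x v - y v = lap f v" if "v \<in> {1..n}" for v
  proof -
    have "v - 1 < n" using that by auto
    then have "x (v - 1 + 1) - y (v - 1 + 1) = lap f (v - 1 + 1)"
      using incidence_laplacian[OF z(1), of "v - 1" f] z(2)[symmetric] by (simp add: f_def)
    then show ?thesis using that by simp
  qed
  then show "fequiv x y" unfolding fequiv_def by (intro exI[of _ f]) (simp add: f_def)
qed

end

section \<open>The isomorphism with the cokernel of the dual Laplacian\<close>

lemma (in comm_group) rcos_eq_iff:
  assumes "subgroup H G" "x \<in> carrier G" "y \<in> carrier G"
  shows "H #> x = H #> y \<longleftrightarrow> (\<exists>h\<in>H. x = h \<otimes> y)"
  using assms repr_independence[of x H y] rcos_self[of x H] by (auto simp: r_coset_def)

theorem proposition3p3:
  fixes n :: nat and E :: "nat set set" and es :: "(nat \<times> nat) list"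
    and fs :: "int vec list" and \<iota> :: "int mat" and g :: nat
  assumes "simple_graph n E"
    and "connected_graph n E"
    and "orientation E es"
    and "Z_basis (card E) (flow_lattice n es) fs"
    and "\<iota> = mat_of_cols (card E) fs"
    and "g = cycle_rank n E"
  shows "group (critical_group n E) \<and>
    critical_group n E \<cong>
      monoid_vec TYPE(int) g Mod ((\<lambda>x. dual_laplacian \<iota> *\<^sub>v x) ` carrier_vec g)"
proof -
  interpret oriented_graph n E es by unfold_locales fact+
  let ?m = "length es" and ?k = "length fs"
  have basis: "set fs \<subseteq> flow_lattice n es"
    "\<And>f. f \<in> flow_lattice n es \<Longrightarrow> \<exists>x\<in>carrier_vec ?k. f = \<iota> *\<^sub>v x"
    "\<And>x. x \<in> carrier_vec ?k \<Longrightarrow> \<iota> *\<^sub>v x = 0\<^sub>v ?m \<Longrightarrow> x = 0\<^sub>v ?k"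
    and \<iota>: "\<iota> = mat_of_cols ?m fs"
    using assms(4,5) by (auto simp: Z_basis_def card_edges)
  have \<iota>_carrier: "\<iota> \<in> carrier_mat ?m ?k" by (simp add: \<iota>)
  have "D * \<iota> = 0\<^sub>m n ?k"
  proof (rule eq_matI)
    fix i j assume "i < dim_row (0\<^sub>m n ?k :: int mat)" "j < dim_col (0\<^sub>m n ?k :: int mat)"
    then have ij: "i < n" "j < ?k" by auto
    then have "fs ! j \<in> flow_lattice n es" using basis(1) nth_mem by blast
    then have fj: "fs ! j \<in> carrier_vec ?m" "D *\<^sub>v (fs ! j) = 0\<^sub>v n"
      by (auto simp: flow_lattice_eq)
    have "(D * \<iota>) $$ (i, j) = (D *\<^sub>v (fs ! j)) $ i"
      using ij fj(1) by (simp add: \<iota>)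
    also note fj(2)
    finally show "(D * \<iota>) $$ (i, j) = 0\<^sub>m n ?k $$ (i, j)" using ij by simp
  qed (use \<iota>_carrier in auto)
  moreover obtain S where S: "S \<in> carrier_mat ?m n" "D * S = 1\<^sub>m n" by (rule section_exists)
  \<comment> \<open>With flows identified as the kernel of \<open>D\<close>, the spanning half of
    the basis property is exactness and the independence half is injectivity of
    \<open>\<iota>\<close>.\<close>
  ultimately interpret split_exact n ?m ?k D S \<iota>
    using basis \<iota>_carrier by unfold_locales (auto simp: flow_lattice_eq)
  \<comment> \<open>By \<open>rank_eq\<close> there are \<open>?k + n\<close> edges, and there are
    \<open>n + 1\<close> vertices, so the cycle rank is \<open>?k\<close>.\<close>
  have g: "g = ?k"
    using rank_eq assms(6) by (simp add: cycle_rank_def card_edges)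
  let ?L = "dual_laplacian \<iota>"
  have L: "?L = \<iota>\<^sup>T * \<iota>" and L_carrier: "?L \<in> carrier_mat g g"
    using \<iota>_carrier by (auto simp: dual_laplacian_def g)
  let ?M = "monoid_vec TYPE(int) g" and ?H = "(\<lambda>x. ?L *\<^sub>v x) ` carrier_vec g"
  interpret M: comm_group ?M by (rule comm_group_vec)
  have M: "carrier ?M = carrier_vec g" "x \<otimes>\<^bsub>?M\<^esub> y = x + y" "\<one>\<^bsub>?M\<^esub> = 0\<^sub>v g" for x y
    by (simp_all add: monoid_vec_simps)
  have H: "subgroup ?H ?M"
  proof (rule M.subgroupI)
    show "?H \<subseteq> carrier ?M" using L_carrier by (auto simp: M)
    show "?H \<noteq> {}" using zero_carrier_vec[of g] by blast
    fix a b assume "a \<in> ?H" "b \<in> ?H"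
    then obtain x y where x: "x \<in> carrier_vec g" "a = ?L *\<^sub>v x"
      and y: "y \<in> carrier_vec g" "b = ?L *\<^sub>v y" by auto
    have "a + b = ?L *\<^sub>v (x + y)"
      by (simp add: x y mult_add_distrib_mat_vec[OF L_carrier x(1) y(1)])
    then show "a \<otimes>\<^bsub>?M\<^esub> b \<in> ?H" using x y by (auto simp: M)
    have a: "a \<in> carrier_vec g" using L_carrier x by simp
    have "?L *\<^sub>v (0\<^sub>v g - x) = ?L *\<^sub>v 0\<^sub>v g - a"
      unfolding x(2) by (rule mult_minus_distrib_mat_vec[OF L_carrier zero_carrier_vec x(1)])
    also have "?L *\<^sub>v 0\<^sub>v g = 0\<^sub>v g" by (rule mult_mat_zero_vec[OF L_carrier])
    finally have "?L *\<^sub>v (0\<^sub>v g - x) = 0\<^sub>v g - a" .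
    moreover have "0\<^sub>v g - a + a = 0\<^sub>v g" by (rule eq_vecI) (use a in auto)
    ultimately have "?L *\<^sub>v (0\<^sub>v g - x) + a = 0\<^sub>v g" by simp
    then have "inv\<^bsub>?M\<^esub> a = ?L *\<^sub>v (0\<^sub>v g - x)"
      using a x L_carrier by (intro M.inv_equality) (auto simp: M)
    then show "inv\<^bsub>?M\<^esub> a \<in> ?H" using x by auto
  qed
  then interpret normal ?H ?M by (rule M.subgroup_imp_normal)
  \<comment> \<open>Lift a chip vector to the edges along paths from the root, then pair the result
    with the basis flows.\<close>
  define T where "T x = \<iota>\<^sup>T *\<^sub>v (S *\<^sub>v vec n (\<lambda>i. x (i + 1)))" for x :: "nat \<Rightarrow> int"
  have \<iota>T: "\<iota>\<^sup>T \<in> carrier_mat g ?m" using \<iota>_carrier by (simp add: g)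
  have T_carrier: "T x \<in> carrier_vec g" for x
    unfolding T_def by (intro mult_mat_vec_carrier[OF \<iota>T] mult_mat_vec_carrier[OF S(1)]) simp
  have T_add: "T (\<lambda>v. x v + y v) = T x + T y" for x y
  proof -
    have "vec n (\<lambda>i. x (i + 1) + y (i + 1)) = vec n (\<lambda>i. x (i + 1)) + vec n (\<lambda>i. y (i + 1))"
      by auto
    then show ?thesis
      using S(1) \<iota>T unfolding T_def
      by (simp add: mult_add_distrib_mat_vec[OF S(1)] mult_add_distrib_mat_vec[OF \<iota>T])
  qed
  have T_ker: "T x \<in> ?H \<longleftrightarrow> fequiv x (\<lambda>v. 0)" for x
    using dual_quotient[of "vec n (\<lambda>i. x (i + 1))"]
    by (auto simp: T_def fequiv_iff_incidence image_iff L g)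
  have T_surj: "\<exists>x. \<exists>h\<in>?H. y = h + T x" if y: "y \<in> carrier_vec g" for y
  proof -
    obtain c w where c: "c \<in> carrier_vec n" and w: "w \<in> carrier_vec g"
      and y: "y = \<iota>\<^sup>T *\<^sub>v (S *\<^sub>v c) + ?L *\<^sub>v w"
      using dual_quotient_surj[of y] y by (auto simp: L g)
    have "vec n (\<lambda>i. c $ i) = c" using c by auto
    then have Tc: "\<iota>\<^sup>T *\<^sub>v (S *\<^sub>v c) = T (\<lambda>v. c $ (v - 1))" by (simp add: T_def)
    have "y = ?L *\<^sub>v w + T (\<lambda>v. c $ (v - 1))"
      unfolding y Tc
      by (rule comm_add_vec[OF T_carrier]) (rule mult_mat_vec_carrier[OF L_carrier w])
    then show ?thesis using w by blast
  qed
  define \<psi> where "\<psi> x = ?H #>\<^bsub>?M\<^esub> T x" for x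
  have "group (?M Mod ?H)" by (rule factorgroup_is_group)
  moreover have "\<psi> x \<in> carrier (?M Mod ?H)" for x
    using T_carrier by (auto simp: carrier_FactGroup \<psi>_def M)
  moreover have "\<psi> (\<lambda>v. x v + y v) = \<psi> x \<otimes>\<^bsub>?M Mod ?H\<^esub> \<psi> y" for x y
    using rcos_sum[of "T x" "T y"] T_carrier by (simp add: \<psi>_def T_add M)
  moreover have "\<exists>x. \<psi> x = q" if q: "q \<in> carrier (?M Mod ?H)" for q
  proof -
    obtain y where y: "y \<in> carrier_vec g" "q = ?H #>\<^bsub>?M\<^esub> y"
      using q by (auto simp: carrier_FactGroup M)
    obtain x where "\<exists>h\<in>?H. y = h + T x" using T_surj[OF y(1)] by blast
    then have "?H #>\<^bsub>?M\<^esub> y = \<psi> x"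
      using M.rcos_eq_iff[OF H, of y "T x"] y T_carrier by (auto simp: \<psi>_def M)
    with y show ?thesis by metis
  qed
  moreover have "\<psi> x = \<psi> y \<longleftrightarrow> fequiv x y" for x y
  proof -
    have xy: "T x = T (\<lambda>v. x v - y v) + T y"
      using T_add[of "\<lambda>v. x v - y v" y] by simp
    have "\<psi> x = \<psi> y \<longleftrightarrow> (\<exists>h\<in>?H. T x = h + T y)"
      using M.rcos_eq_iff[OF H, of "T x" "T y"] T_carrier by (simp add: \<psi>_def M)
    also have "\<dots> \<longleftrightarrow> T (\<lambda>v. x v - y v) \<in> ?H"
    proof
      assume "\<exists>h\<in>?H. T x = h + T y"
      then obtain h where h: "h \<in> ?H" "T x = h + T y" by blast
      have "h \<in> carrier_vec g" using h(1) L_carrier by auto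
      then have "T (\<lambda>v. x v - y v) = h"
        using M.right_cancel[of "T y" "T (\<lambda>v. x v - y v)" h] h(2) xy T_carrier by (simp add: M)
      with h show "T (\<lambda>v. x v - y v) \<in> ?H" by simp
    qed (use xy in blast)
    also have "\<dots> \<longleftrightarrow> fequiv x y" by (simp add: T_ker fequiv_def)
    finally show ?thesis .
  qed
  ultimately show ?thesis using critical_group_iso[of "?M Mod ?H" \<psi>] by blast
qed

end
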